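(* Let $\Delta$ be a reflexive polytope and $h$ a height function, and let $\nu=\frac{\mu_M(A)}{\nu_N(B)}\nu_N$. Assume $(\Delta,h)$ is structurally strictly semistable and the equation $\mathrm{MA}(\Psi|_{B^\circ})=\nu$ admits a solution $\Psi\in\mathcal P(\Delta)$. Then $B\setminus\Sigma_\Psi$ is not connected.
   Context: Let $d\ge 1$, $M\cong\mathbb Z^{d+1}$ a lattice, $N=\mathrm{Hom}(M,\mathbb Z)$, $M_{\mathbb R},N_{\mathbb R}$ the real vector spaces with pairing $\langle\cdot,\cdot\rangle$. A reflexive polytope $\Delta\subset M_{\mathbb R}$ is a lattice polytope with $0$ in its interior whose dual is a lattice polytope. A height function is $h:\Delta\cap M\to\mathbb Z$ with $h(0)=0<h(m)$ for $m\ne0$. $\Delta_h^\vee=\{n:\langle m,n\rangle\le h(m)\ \forall m\in\Delta\cap M\}$, $A=\partial\Delta$, $B=\partial\Delta_h^\vee$; $B^\circ$ is the union of the relative interiors $\tau^\circ$ of facets $\tau$ of $\Delta_h^\vee$ and $B_{d-1}=B\setminus B^\circ$. For a facet $\sigma$ of $\Delta$, $n_\sigma\in N$ is its primitive outward normal and $\sigma^\circ$ its relative interior; for a facet $\tau$ of $\Delta_h^\vee$, $m_\tau\in A\cap M$ is its primitive outward normal. For $m\in A\cap M$, $\tau_m=\{n\in\Delta_h^\vee:\langle m,n\rangle=h(m)\}$ and $\mathrm{St}(m)$ is the union of the closed faces of $A$ containing $m$. $\mu_M$ (resp. $\nu_N$) is the measure on $A$ (resp. $B$) equal on each facet $\sigma$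 (resp. $\tau$) to Lebesgue measure normalized by the lattice $n_\sigma^\perp\cap M$ (resp. $m_\tau^\perp\cap N$). $(\Delta,h)$ is structurally unstable if $\nu(\tau)>\mu_M(\mathrm{St}(m_\tau))$ for some facet $\tau$ of $\Delta_h^\vee$, or $\mu_M(\sigma)>\nu(\bigcup_{m\in\sigma\cap M}\tau_m)$ for some facet $\sigma$ of $\Delta$. It is structurally strictly semistable if it is not structurally unstable, but $\nu(\tau)=\mu_M(\mathrm{St}(m_\tau))$ for some facet $\tau$ of $\Delta_h^\vee$ or $\mu_M(\sigma)=\nu(\bigcup_{m\in\sigma\cap M}\tau_m)$ for some facet $\sigma$ of $\Delta$. $\mathcal P(\Delta)$ is the set of convex $\Psi:N_{\mathbb R}\to\mathbb R$ with $\sup_n|\Psi(n)-\sup_{m\in\Delta\cap M}\langle m,n\rangle|<\infty$. $\beta_\sigma(n)=(\langle m_1,n\rangle,\dots,\langle m_d,n\rangle)$ for a $\mathbb Z$-basis $m_1,\dots,m_d$ of $n_\sigma^\perp\cap M$. $\mathrm{MA}(\Psi|_{B^\circ})=\nu$ means: for every facet $\tau$ of $\Delta_h^\vee$, facet $\sigma$ of $\Delta$ with $m_\tau\in\sigma$, and measurable $E\subset\tau^\circ$, $|\partial(\Psi\circ\beta_\sigma^{-1})(\beta_\sigma(E))|=\nu(E)$, where $\beta_\sigma^{-1}$ is the inverse of $\beta_\sigma|_{\tau^\circ}$, $\partial$ is the subgradient of the convex function on $\beta_\sigma(\tau^\circ)$ and $|\cdot|$ is Lebesgue measure. $\Psi^c(m)=\sup_{n\in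 B}\langle m,n\rangle-\Psi(n)$ for $m\in A$; $\partial^c\Psi^c(m)=\{n\in B:\Psi^c(m')\ge\Psi^c(m)+\langle m'-m,n\rangle\ \forall m'\in A\}$; $U_\sigma=B\setminus\partial^c\Psi^c(A\setminus\sigma^\circ)$ for each facet $\sigma$ of $\Delta$; $\Sigma_\Psi=B_{d-1}\setminus\bigcup_\sigma U_\sigma$. *)

theory Defs
  imports "HOL-Analysis.Analysis"
begin

text \<open>
  Both real vector spaces are \<^typ>\<open>real ^ 'd option\<close>, of dimension \<open>d + 1\<close> for
  \<open>d = CARD('d) \<ge> 1\<close>. A basis of \<open>M\<close> and its dual basis of \<open>N\<close> are fixed, so that both lattices
  become the integer lattice and the pairing becomes the standard inner product.
\<close>

definition int_lattice :: "(real ^ 'n) set" where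
  "int_lattice = {x. \<forall>i. x $ i \<in> \<int>}"

definition primitive :: "real ^ 'n \<Rightarrow> bool" where
  "primitive v \<longleftrightarrow> v \<in> int_lattice \<and> v \<noteq> 0 \<and>
     (\<forall>w\<in>int_lattice. \<forall>k::nat. v = real k *\<^sub>R w \<longrightarrow> k = 1)"

definition lattice_polytope :: "(real ^ 'n) set \<Rightarrow> bool" where
  "lattice_polytope P \<longleftrightarrow> (\<exists>V. finite V \<and> V \<subseteq> int_lattice \<and> P = convex hull V)"

definition dual_polytope :: "(real ^ 'n) set \<Rightarrow> (real ^ 'n) set" where
  "dual_polytope P = {n. \<forall>m\<in>P. m \<bullet> n \<le> 1}"

definition reflexive_polytope :: "(real ^ 'n) set \<Rightarrow> bool" where
  "reflexive_polytope P \<longleftrightarrow>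
     lattice_polytope P \<and> 0 \<in> interior P \<and> lattice_polytope (dual_polytope P)"

text \<open>Only the values of \<open>h\<close> on the lattice points of \<open>\<Delta>\<close> are ever used.\<close>

definition height_function :: "(real ^ 'n) set \<Rightarrow> (real ^ 'n \<Rightarrow> int) \<Rightarrow> bool" where
  "height_function \<Delta> h \<longleftrightarrow> h 0 = 0 \<and> (\<forall>m \<in> \<Delta> \<inter> int_lattice. m \<noteq> 0 \<longrightarrow> 0 < h m)"

definition dual_h :: "(real ^ 'n) set \<Rightarrow> (real ^ 'n \<Rightarrow> int) \<Rightarrow> (real ^ 'n) set" where
  "dual_h \<Delta> h = {n. \<forall>m \<in> \<Delta> \<inter> int_lattice. m \<bullet> n \<le> of_int (h m)}"

definition outer_normal :: "(real ^ 'n) set \<Rightarrow> (real ^ 'n) set \<Rightarrow> real ^ 'n" where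
  "outer_normal P F = (THE v. primitive v \<and>
     (\<exists>c. P \<subseteq> {x. v \<bullet> x \<le> c} \<and> F = P \<inter> {x. v \<bullet> x = c}))"

definition tau :: "(real ^ 'n) set \<Rightarrow> (real ^ 'n \<Rightarrow> int) \<Rightarrow> real ^ 'n \<Rightarrow> (real ^ 'n) set" where
  "tau \<Delta> h m = {n \<in> dual_h \<Delta> h. m \<bullet> n = of_int (h m)}"

definition St :: "(real ^ 'n) set \<Rightarrow> real ^ 'n \<Rightarrow> (real ^ 'n) set" where
  "St \<Delta> m = \<Union>{F. F face_of \<Delta> \<and> F \<noteq> \<Delta> \<and> m \<in> F}"


subsection \<open>Lattice-normalized measures\<close>

definition is_lattice_basis :: "(real ^ 'n) set \<Rightarrow> ('d::finite \<Rightarrow> real ^ 'n) \<Rightarrow> bool" where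
  "is_lattice_basis L b \<longleftrightarrow>
     bij_betw (\<lambda>k::'d \<Rightarrow> int. \<Sum>i\<in>UNIV. of_int (k i) *\<^sub>R b i) UNIV L"

text \<open>A choice of \<open>\<int>\<close>-basis of the rank \<open>d\<close> lattice orthogonal to \<open>v\<close>; another choice changes
  coordinates by a unimodular matrix, which affects none of the measures below.\<close>

definition perp_basis :: "real ^ 'd option \<Rightarrow> 'd::finite \<Rightarrow> real ^ 'd option" where
  "perp_basis v = (SOME b. is_lattice_basis {x \<in> int_lattice. v \<bullet> x = 0} b)"

text \<open>Lebesgue measure on the affine hull of the facet \<open>F\<close> of \<open>P\<close>, such that a fundamental
  parallelepiped of the lattice orthogonal to the normal has measure 1. The base point in \<open>F\<close> is
  irrelevant by translation invariance.\<close>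

definition facet_measure ::
  "(real ^ 'd option) set \<Rightarrow> (real ^ 'd option) set \<Rightarrow> (real ^ 'd::finite option) measure" where
  "facet_measure P F = distr lborel borel
     (\<lambda>y::real ^ 'd. (SOME p. p \<in> F) + (\<Sum>i\<in>UNIV. (y $ i) *\<^sub>R perp_basis (outer_normal P F) i))"

text \<open>Distinct facets overlap in null sets, so the sum restricts to the given measure on each
  facet.\<close>

definition boundary_measure ::
  "(real ^ 'd option) set \<Rightarrow> (real ^ 'd::finite option) measure" where
  "boundary_measure P = measure_of UNIV (sets borel)
     (\<lambda>E. \<Sum>F | F facet_of P. emeasure (facet_measure P F) (E \<inter> F))"

lemma sets_boundary_measure [simp]: "sets (boundary_measure P) = sets borel"
  unfolding boundary_measure_def using sets.sets_measure_of_eq[of borel]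
  by (simp only: space_borel)

lemma emeasure_boundary_measure:
  fixes P :: "(real ^ 'd::finite option) set"
  assumes "polytope P" "E \<in> sets borel"
  shows "emeasure (boundary_measure P) E =
    (\<Sum>F | F facet_of P. emeasure (facet_measure P F) (E \<inter> F))"
proof -
  let ?m = "\<lambda>E. \<Sum>F | F facet_of P. emeasure (facet_measure P F) (E \<inter> F)"
  have F: "F \<in> sets borel" if "F facet_of P" for F
    by (rule borel_closed[OF polytope_imp_closed[OF face_of_polytope_polytope[OF assms(1)
          facet_of_imp_face_of[OF that]]]])
  have sets: "sets (facet_measure P F) = sets borel" for F
    by (simp add: facet_measure_def)
  have "countably_additive (sets borel) ?m"
  proof (rule countably_additiveI)
    fix X :: "nat \<Rightarrow> (real ^ 'd option) set"
    assume X: "range X \<subseteq> sets borel" "disjoint_family X"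
    have eq: "(\<Sum>i. emeasure (facet_measure P F) (X i \<inter> F)) =
        emeasure (facet_measure P F) (\<Union>(range X) \<inter> F)" if "F facet_of P" for F
    proof -
      have "range (\<lambda>i. X i \<inter> F) \<subseteq> sets (facet_measure P F)"
        using X(1) F[OF that] sets by auto
      moreover have "disjoint_family (\<lambda>i. X i \<inter> F)"
        using X(2) by (auto simp: disjoint_family_on_def)
      ultimately have "(\<Sum>i. emeasure (facet_measure P F) (X i \<inter> F)) =
          emeasure (facet_measure P F) (\<Union>i. X i \<inter> F)"
        by (rule suminf_emeasure)
      also have "(\<Union>i. X i \<inter> F) = \<Union>(range X) \<inter> F"
        by blast
      finally show ?thesis .
    qed
    have "(\<Sum>i. ?m (X i)) = (\<Sum>F | F facet_of P. \<Sum>i. emeasure (facet_measure P F) (X i \<inter> F))"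
      by (rule suminf_sum) (rule summableI)
    also have "\<dots> = ?m (\<Union>(range X))"
      by (rule sum.cong[OF refl], rule eq) simp
    finally show "(\<Sum>i. ?m (X i)) = ?m (\<Union>(range X))" .
  qed
  moreover have "positive (sets borel) ?m"
    by (simp add: positive_def)
  moreover have "sigma_algebra UNIV (sets (borel :: (real ^ 'd option) measure))"
    using sets.sigma_algebra_axioms[of "borel :: (real ^ 'd option) measure"]
    by (simp only: space_borel)
  ultimately show ?thesis
    unfolding boundary_measure_def using assms(2) by (intro emeasure_measure_of_sigma)
qed

definition mu_M :: "(real ^ 'd option) set \<Rightarrow> (real ^ 'd::finite option) measure" where
  "mu_M \<Delta> = boundary_measure \<Delta>"

definition nu_N ::
  "(real ^ 'd option) set \<Rightarrow> (real ^ 'd option \<Rightarrow> int) \<Rightarrow> (real ^ 'd::finite option) measure" where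
  "nu_N \<Delta> h = boundary_measure (dual_h \<Delta> h)"

definition nu ::
  "(real ^ 'd option) set \<Rightarrow> (real ^ 'd option \<Rightarrow> int) \<Rightarrow> (real ^ 'd::finite option) measure" where
  "nu \<Delta> h = scale_measure
     (emeasure (mu_M \<Delta>) (frontier \<Delta>) / emeasure (nu_N \<Delta> h) (frontier (dual_h \<Delta> h))) (nu_N \<Delta> h)"


subsection \<open>Structural stability\<close>

definition structurally_unstable ::
  "(real ^ 'd::finite option) set \<Rightarrow> (real ^ 'd option \<Rightarrow> int) \<Rightarrow> bool" where
  "structurally_unstable \<Delta> h \<longleftrightarrow>
     (\<exists>\<tau>. \<tau> facet_of dual_h \<Delta> h \<and>
        emeasure (nu \<Delta> h) \<tau> > emeasure (mu_M \<Delta>) (St \<Delta> (outer_normal (dual_h \<Delta> h) \<tau>))) \<or>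
     (\<exists>\<sigma>. \<sigma> facet_of \<Delta> \<and>
        emeasure (mu_M \<Delta>) \<sigma> > emeasure (nu \<Delta> h) (\<Union>m \<in> \<sigma> \<inter> int_lattice. tau \<Delta> h m))"

definition structurally_strictly_semistable ::
  "(real ^ 'd::finite option) set \<Rightarrow> (real ^ 'd option \<Rightarrow> int) \<Rightarrow> bool" where
  "structurally_strictly_semistable \<Delta> h \<longleftrightarrow>
     \<not> structurally_unstable \<Delta> h \<and>
     ((\<exists>\<tau>. \<tau> facet_of dual_h \<Delta> h \<and>
        emeasure (nu \<Delta> h) \<tau> = emeasure (mu_M \<Delta>) (St \<Delta> (outer_normal (dual_h \<Delta> h) \<tau>))) \<or>
      (\<exists>\<sigma>. \<sigma> facet_of \<Delta> \<and>
        emeasure (mu_M \<Delta>) \<sigma> = emeasure (nu \<Delta> h) (\<Union>m \<in> \<sigma> \<inter> int_lattice. tau \<Delta> h m)))"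


subsection \<open>The Monge--Ampere equation\<close>

definition PP :: "(real ^ 'n) set \<Rightarrow> (real ^ 'n \<Rightarrow> real) set" where
  "PP \<Delta> = {\<Psi>. convex_on UNIV \<Psi> \<and>
     bdd_above (range (\<lambda>n. \<bar>\<Psi> n - (SUP m \<in> \<Delta> \<inter> int_lattice. m \<bullet> n)\<bar>))}"

definition beta ::
  "(real ^ 'd option) set \<Rightarrow> (real ^ 'd option) set \<Rightarrow> real ^ 'd option \<Rightarrow> real ^ 'd::finite" where
  "beta \<Delta> \<sigma> n = (\<chi> i. perp_basis (outer_normal \<Delta> \<sigma>) i \<bullet> n)"

definition subgradient ::
  "(real ^ 'n) set \<Rightarrow> (real ^ 'n \<Rightarrow> real) \<Rightarrow> real ^ 'n \<Rightarrow> (real ^ 'n) set" where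
  "subgradient U u x = {p. \<forall>y\<in>U. u y \<ge> u x + p \<bullet> (y - x)}"

definition MA_equation ::
  "(real ^ 'd::finite option) set \<Rightarrow> (real ^ 'd option \<Rightarrow> int) \<Rightarrow> (real ^ 'd option \<Rightarrow> real) \<Rightarrow> bool"
where
  "MA_equation \<Delta> h \<Psi> \<longleftrightarrow>
     (\<forall>\<tau> \<sigma> E. \<tau> facet_of dual_h \<Delta> h \<and> \<sigma> facet_of \<Delta> \<and> outer_normal (dual_h \<Delta> h) \<tau> \<in> \<sigma> \<and>
        E \<in> sets borel \<and> E \<subseteq> rel_interior \<tau> \<longrightarrow>
        emeasure lebesgue (\<Union>x \<in> beta \<Delta> \<sigma> ` E.
          subgradient (beta \<Delta> \<sigma> ` rel_interior \<tau>)
            (\<Psi> \<circ> inv_into (rel_interior \<tau>) (beta \<Delta> \<sigma>)) x) = emeasure (nu \<Delta> h) E)"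


subsection \<open>The c-transform and the singular set\<close>

definition c_transform ::
  "(real ^ 'n) set \<Rightarrow> (real ^ 'n \<Rightarrow> int) \<Rightarrow> (real ^ 'n \<Rightarrow> real) \<Rightarrow> real ^ 'n \<Rightarrow> real" where
  "c_transform \<Delta> h \<Psi> m = (SUP n \<in> frontier (dual_h \<Delta> h). m \<bullet> n - \<Psi> n)"

definition c_subgradient ::
  "(real ^ 'n) set \<Rightarrow> (real ^ 'n \<Rightarrow> int) \<Rightarrow> (real ^ 'n \<Rightarrow> real) \<Rightarrow> real ^ 'n \<Rightarrow> (real ^ 'n) set" where
  "c_subgradient \<Delta> h \<Psi> m = {n \<in> frontier (dual_h \<Delta> h).
     \<forall>m' \<in> frontier \<Delta>. c_transform \<Delta> h \<Psi> m' \<ge> c_transform \<Delta> h \<Psi> m + (m' - m) \<bullet> n}"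

definition U_set ::
  "(real ^ 'n) set \<Rightarrow> (real ^ 'n \<Rightarrow> int) \<Rightarrow> (real ^ 'n \<Rightarrow> real) \<Rightarrow> (real ^ 'n) set \<Rightarrow> (real ^ 'n) set"
where
  "U_set \<Delta> h \<Psi> \<sigma> = frontier (dual_h \<Delta> h) -
     (\<Union>m \<in> frontier \<Delta> - rel_interior \<sigma>. c_subgradient \<Delta> h \<Psi> m)"

definition B_open :: "(real ^ 'n) set \<Rightarrow> (real ^ 'n \<Rightarrow> int) \<Rightarrow> (real ^ 'n) set" where
  "B_open \<Delta> h = (\<Union>\<tau> \<in> {\<tau>. \<tau> facet_of dual_h \<Delta> h}. rel_interior \<tau>)"

definition B_skel :: "(real ^ 'n) set \<Rightarrow> (real ^ 'n \<Rightarrow> int) \<Rightarrow> (real ^ 'n) set" where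
  "B_skel \<Delta> h = frontier (dual_h \<Delta> h) - B_open \<Delta> h"

definition Sigma_sing ::
  "(real ^ 'n) set \<Rightarrow> (real ^ 'n \<Rightarrow> int) \<Rightarrow> (real ^ 'n \<Rightarrow> real) \<Rightarrow> (real ^ 'n) set" where
  "Sigma_sing \<Delta> h \<Psi> = B_skel \<Delta> h - (\<Union>\<sigma> \<in> {\<sigma>. \<sigma> facet_of \<Delta>}. U_set \<Delta> h \<Psi> \<sigma>)"

end

theory Submission imports Defs begin

text \<open>
  A solution of the equation transports \<open>\<nu>\<close> to \<open>\<mu>\<^sub>M\<close>, and the mass of a facet \<open>\<tau>\<close> of the polytope
  \<open>\<Delta>\<^sub>h = dual_h \<Delta> h\<close> can only go to the facets of \<open>\<Delta>\<close> that contain its normal \<open>m\<^sub>\<tau>\<close>. Equality in one of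
  the stability inequalities leaves no spare room for this transport. A regular point on the common
  boundary of two facets would force mass of both facets into one facet of \<open>\<Delta>\<close>, and hence exceed
  the room.

  Call \<open>m\<close> in contact with \<open>n\<close> if \<open>\<Psi> n' \<ge> \<Psi> n + \<langle>m, n' - n\<rangle>\<close> for all \<open>n'\<close> in \<open>\<Delta>\<^sub>h\<close>; then \<open>n\<close> is in the
  c-subgradient of \<open>\<Psi>\<^sup>c\<close> at \<open>m\<close>. A subgradient of \<open>\<Psi>\<close> along a facet \<open>\<tau>\<close> is determined only modulo
  \<open>m\<^sub>\<tau>\<close>. It lifts to a subgradient of \<open>\<Psi>\<close> on the whole space, which lies in \<open>\<Delta>\<close> by the growth of
  \<open>\<Psi>\<close>. Moving it in direction \<open>m\<^sub>\<tau>\<close> until it leaves \<open>\<Delta>\<close> keeps the contact inequality on \<open>\<Delta>\<^sub>h\<close>, and by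
  reflexivity the exit point is on a facet containing \<open>m\<^sub>\<tau>\<close>
  (\<open>contact_of_facet_subgradient\<close>). The projection along \<open>m\<^sub>\<tau>\<close> identifies the lattices of all
  these facets, so it preserves the normalized volumes (\<open>shadow_measure\<close>). Hence the \<open>\<nu>\<close>-mass of a
  compact part of \<open>\<tau>\<close> is at most the mass of its contact points (\<open>MA_le_contact_sets\<close>). Contact sets of
  different facets of \<open>\<Delta>\<^sub>h\<close> overlap in null sets (\<open>contact_sets_almost_disjoint\<close>). Altogether, if all
  contact points of \<open>E\<close> on the boundary of \<open>\<Delta>\<close> are in \<open>X\<close>, then \<open>\<nu>(E) \<le> \<mu>\<^sub>M(X)\<close> (\<open>transport_bound\<close>).

  Now let \<open>n\<^sub>0 \<in> U\<^sub>\<sigma>\<close> be on two facets \<open>\<tau> \<noteq> \<tau>'\<close>. As \<open>U\<^sub>\<sigma>\<close> is open, all contacts of nearby points are in the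
  interior of \<open>\<sigma>\<close>, and the transport bound gives \<open>m\<^sub>\<tau>, m\<^sub>\<tau>\<^sub>' \<in> \<sigma>\<close>. If \<open>\<nu>(\<tau>) = \<mu>\<^sub>M(St(m\<^sub>\<tau>))\<close>, then \<open>\<tau>\<close> together
  with a small part of \<open>\<tau>'\<close> has all its contacts in \<open>St(m\<^sub>\<tau>)\<close>, but too much mass
  (\<open>star_separation\<close>). If \<open>\<mu>\<^sub>M(\<sigma>\<^sub>0)\<close> equals the mass of the facets with normal in \<open>\<sigma>\<^sub>0\<close>, the complements
  also have equal mass. So for \<open>m\<^sub>\<tau> \<in> \<sigma>\<^sub>0\<close>, \<open>m\<^sub>\<tau>\<^sub>' \<notin> \<sigma>\<^sub>0\<close> the facets with normal outside \<open>\<sigma>\<^sub>0\<close>, together with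
  a small part of \<open>\<tau>\<close>, have too much mass for the complement of \<open>\<sigma>\<^sub>0\<close> (\<open>facet_separation\<close>). In either
  case the facets of \<open>\<Delta>\<^sub>h\<close> fall into two nonempty families whose unions are closed, cover the boundary
  and do not meet in a regular point.
\<close>

section \<open>Automorphisms and bases of the integer lattice\<close>

definition lattice_automorphism :: "(real ^ 'n \<Rightarrow> real ^ 'n) \<Rightarrow> bool" where
  "lattice_automorphism L \<longleftrightarrow> linear L \<and> bij L \<and> L ` int_lattice = int_lattice"

lemma lattice_automorphismI:
  assumes "linear L" "\<And>x. L (L' x) = x" "\<And>x. L' (L x) = x"
    "\<And>x. x \<in> int_lattice \<Longrightarrow> L x \<in> int_lattice" "\<And>x. x \<in> int_lattice \<Longrightarrow> L' x \<in> int_lattice"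
  shows "lattice_automorphism L"
proof -
  have "bij L"
    using assms(2,3) by (metis bijI')
  moreover have "int_lattice \<subseteq> L ` int_lattice"
    using assms(2,5) by (metis image_eqI subsetI)
  ultimately show ?thesis
    using assms(1,4) by (auto simp: lattice_automorphism_def)
qed

lemma lattice_automorphism_compose:
  assumes "lattice_automorphism L" "lattice_automorphism L'"
  shows "lattice_automorphism (\<lambda>x. L (L' x))"
  using assms linear_compose[of L' L] bij_comp[of L' L] image_comp[of L L' int_lattice]
  by (simp add: lattice_automorphism_def o_def)

lemma inner_int_lattice: "x \<in> int_lattice \<Longrightarrow> y \<in> int_lattice \<Longrightarrow> x \<bullet> y \<in> \<int>"
  by (auto simp: int_lattice_def inner_vec_def intro!: Ints_sum Ints_mult)

lemma int_lattice_diff: "x \<in> int_lattice \<Longrightarrow> y \<in> int_lattice \<Longrightarrow> x - y \<in> int_lattice"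
  by (auto simp: int_lattice_def)

lemma int_lattice_scaleR: "c \<in> \<int> \<Longrightarrow> x \<in> int_lattice \<Longrightarrow> c *\<^sub>R x \<in> int_lattice"
  by (auto simp: int_lattice_def)

lemma int_lattice_axis: "c \<in> \<int> \<Longrightarrow> axis i c \<in> int_lattice"
  by (auto simp: int_lattice_def axis_def)

lemma Ints_mult_eq_1:
  fixes x y :: real
  assumes "x \<in> \<int>" "y \<in> \<int>" "x * y = 1"
  shows "x = 1 \<or> x = -1"
proof -
  obtain a b where ab: "x = of_int a" "y = of_int b"
    using assms(1,2) by (auto elim!: Ints_cases)
  then have "real_of_int (a * b) = of_int 1"
    using assms(3) by simp
  then have "a * b = 1"
    by (simp only: of_int_eq_iff)
  then show ?thesis
    using ab zmult_eq_1_iff[of a b] by auto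
qed

text \<open>
  Euclid's algorithm: while two entries of \<open>v\<close> are nonzero, a transvection subtracts the smaller one in
  absolute value from the larger one. Transforming \<open>u\<close> inversely preserves \<open>v \<bullet> u = 1\<close>, so the last nonzero entry
  divides \<open>1\<close>.
\<close>

lemma unimodular_coordinate:
  fixes v :: "real ^ 'd::finite option"
  assumes "v \<in> int_lattice" "u \<in> int_lattice" "v \<bullet> u = 1"
  shows "\<exists>L. lattice_automorphism L \<and> (\<forall>x. v \<bullet> x = L x $ None)"
  using assms
proof (induction "nat \<lfloor>\<Sum>i\<in>UNIV. \<bar>v $ i\<bar>\<rfloor>" arbitrary: v u rule: less_induct)
  case less
  show ?case
  proof (cases "\<exists>i j. i \<noteq> j \<and> v $ i \<noteq> 0 \<and> v $ j \<noteq> 0 \<and> \<bar>v $ i\<bar> \<le> \<bar>v $ j\<bar>")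
    case True
    then obtain i j where ij: "i \<noteq> j" "v $ i \<noteq> 0" "v $ j \<noteq> 0" "\<bar>v $ i\<bar> \<le> \<bar>v $ j\<bar>"
      by blast
    define s where "s = sgn (v $ i) * sgn (v $ j)"
    define v' where "v' = v - axis j (s * v $ i)"
    define E where "E = (\<lambda>x::real ^ 'd option. x + axis i (s * x $ j))"
    have vint: "v $ k \<in> \<int>" for k
      using less.prems(1) by (simp add: int_lattice_def)
    have s: "s \<in> \<int>"
      by (simp add: s_def sgn_if)
    have v'j: "\<bar>v' $ j\<bar> = \<bar>v $ j\<bar> - \<bar>v $ i\<bar>"
      using ij by (auto simp: v'_def s_def axis_def sgn_if abs_if)
    have v'k: "v' $ k = v $ k" if "k \<noteq> j" for k
      using that by (simp add: v'_def axis_def)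
    have "(\<Sum>k\<in>UNIV. \<bar>v' $ k\<bar>) = \<bar>v' $ j\<bar> + (\<Sum>k\<in>UNIV - {j}. \<bar>v' $ k\<bar>)"
      by (rule sum.remove) auto
    also have "(\<Sum>k\<in>UNIV - {j}. \<bar>v' $ k\<bar>) = (\<Sum>k\<in>UNIV - {j}. \<bar>v $ k\<bar>)"
      by (rule sum.cong) (auto simp: v'k)
    finally have sum: "(\<Sum>k\<in>UNIV. \<bar>v' $ k\<bar>) = (\<Sum>k\<in>UNIV. \<bar>v $ k\<bar>) - \<bar>v $ i\<bar>"
      using v'j sum.remove[of UNIV j "\<lambda>k. \<bar>v $ k\<bar>"] by simp
    have "\<bar>v $ i\<bar> \<ge> 1"
      using vint[of i] ij(2) by (rule Ints_nonzero_abs_ge1)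
    moreover have "(\<Sum>k\<in>UNIV. \<bar>v' $ k\<bar>) \<ge> 0"
      by (simp add: sum_nonneg)
    ultimately have dec: "nat \<lfloor>\<Sum>k\<in>UNIV. \<bar>v' $ k\<bar>\<rfloor> < nat \<lfloor>\<Sum>k\<in>UNIV. \<bar>v $ k\<bar>\<rfloor>"
      using sum by linarith
    have vE: "v' \<bullet> E x = v \<bullet> x" for x
    proof -
      have "v' \<bullet> E x = v \<bullet> x + v' $ i * (s * x $ j) - s * v $ i * x $ j"
        by (simp add: E_def inner_add_right inner_axis) (simp add: v'_def inner_diff_left inner_axis')
      then show ?thesis
        using v'k[OF ij(1)] by simp
    qed
    have E: "lattice_automorphism E"
    proof (rule lattice_automorphismI[where L' = "\<lambda>x. x - axis i (s * x $ j)"])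
      show "linear E"
        by (rule linearI) (auto simp: E_def axis_def vec_eq_iff algebra_simps)
    qed (use ij(1) s in \<open>auto simp: E_def axis_def vec_eq_iff int_lattice_def\<close>)
    have v': "v' \<in> int_lattice"
      unfolding v'_def using s vint less.prems(1)
      by (intro int_lattice_diff int_lattice_axis) auto
    have "E u \<in> int_lattice"
      using E less.prems(2) by (auto simp: lattice_automorphism_def)
    then obtain L where L: "lattice_automorphism L" "\<And>x. v' \<bullet> x = L x $ None"
      using less.hyps[OF dec v', of "E u"] vE[of u] less.prems(3) by auto
    have "lattice_automorphism (\<lambda>x. L (E x))"
      by (rule lattice_automorphism_compose[OF L(1) E])
    then show ?thesis
      using L(2) vE by metis
  next
    case False
    obtain i where i: "v $ i \<noteq> 0"
      using less.prems(3) by (metis inner_zero_left vec_eq_iff zero_index zero_neq_one)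
    have zero: "v $ k = 0" if "k \<noteq> i" for k
      using False i that by (metis linorder_linear)
    define c where "c = v $ i"
    have v: "v = axis i c"
      using zero by (auto simp: vec_eq_iff axis_def c_def)
    have cu: "c * u $ i = 1"
      using less.prems(3) by (simp add: v inner_axis')
    have "c \<in> \<int>" "u $ i \<in> \<int>"
      using less.prems(1,2) by (auto simp: c_def int_lattice_def)
    then have c: "c = 1 \<or> c = -1"
      using cu by (rule Ints_mult_eq_1)
    define L where "L = (\<lambda>x::real ^ 'd option. \<chi> k. if k = None then c * x $ i
      else if k = i then x $ None else x $ k)"
    define L' where "L' = (\<lambda>x::real ^ 'd option. \<chi> k. if k = i then c * x $ None
      else if k = None then x $ i else x $ k)"
    have "lattice_automorphism L"
    proof (rule lattice_automorphismI[where L' = L'])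
      show "linear L"
        by (rule linearI) (auto simp: L_def vec_eq_iff algebra_simps)
    qed (use c in \<open>auto simp: L_def L'_def vec_eq_iff int_lattice_def\<close>)
    moreover have "v \<bullet> x = L x $ None" for x
      by (simp add: v inner_axis' L_def)
    ultimately show ?thesis
      by blast
  qed
qed

lemma is_lattice_basis_iff:
  fixes b :: "'d::finite \<Rightarrow> real ^ 'n::finite"
  shows "is_lattice_basis \<Lambda> b \<longleftrightarrow> bij_betw (\<lambda>y. \<Sum>i\<in>UNIV. y $ i *\<^sub>R b i) int_lattice \<Lambda>"
proof -
  let ?e = "\<lambda>k::'d \<Rightarrow> int. \<chi> i. real_of_int (k i)"
  have "inj ?e"
    by (auto simp: inj_def vec_eq_iff)
  moreover have "y \<in> range ?e" if "y \<in> int_lattice" for y :: "real ^ 'd"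
    using that by (intro image_eqI[of _ _ "\<lambda>i. \<lfloor>y $ i\<rfloor>"])
      (auto simp: int_lattice_def vec_eq_iff elim: Ints_cases)
  ultimately have e: "bij_betw ?e UNIV int_lattice"
    by (auto simp: bij_betw_def int_lattice_def)
  have eq: "(\<lambda>k::'d \<Rightarrow> int. \<Sum>i\<in>UNIV. of_int (k i) *\<^sub>R b i) =
      (\<lambda>y. \<Sum>i\<in>UNIV. y $ i *\<^sub>R b i) \<circ> ?e"
    by (simp add: fun_eq_iff)
  show ?thesis
    unfolding is_lattice_basis_def eq by (simp only: bij_betw_comp_iff[OF e])
qed

definition perp_chart :: "real ^ 'd::finite option \<Rightarrow> real ^ 'd \<Rightarrow> real ^ 'd option" where
  "perp_chart v y = (\<Sum>i\<in>UNIV. y $ i *\<^sub>R perp_basis v i)"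

lemma linear_perp_chart: "linear (perp_chart v)"
  unfolding perp_chart_def
  by (rule linearI) (simp_all add: scaleR_left_distrib sum.distrib scaleR_sum_right)

text \<open>
  In coordinates where \<open>v\<close> is a coordinate function, the lattice orthogonal to \<open>v\<close> is a coordinate
  sublattice. This gives a \<open>\<int>\<close>-basis of it, so the basis chosen by \<open>perp_basis\<close> is one. The lattice spans the
  hyperplane over the reals, and a spanning family with as many members as the dimension is independent.
\<close>

lemma perp_chart:
  fixes v :: "real ^ 'd::finite option"
  assumes v: "v \<in> int_lattice" and u: "u \<in> int_lattice" "v \<bullet> u = 1"
  shows "perp_chart v ` int_lattice = {x \<in> int_lattice. v \<bullet> x = 0}"
    and "range (perp_chart v) = {x. v \<bullet> x = 0}" and "inj (perp_chart v)"
proof -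
  obtain L where L: "lattice_automorphism L" "\<And>x. v \<bullet> x = L x $ None"
    using unimodular_coordinate[OF v u] by blast
  have lin: "linear L" and bij: "bij L" and int: "L ` int_lattice = int_lattice"
    using L(1) by (auto simp: lattice_automorphism_def)
  define J where "J = inv L"
  have LJ [simp]: "L (J x) = x" and JL [simp]: "J (L x) = x" for x
    using bij by (auto simp: J_def bij_is_surj bij_is_inj surj_f_inv_f)
  have J: "linear J"
    by (rule linearI; rule injD[OF bij_is_inj[OF bij]])
       (simp_all add: linear_add[OF lin] linear_cmul[OF lin])
  have Jint: "J x \<in> int_lattice \<longleftrightarrow> x \<in> int_lattice" for x
    using int LJ by (metis JL image_iff)
  define pad where "pad = (\<lambda>y::real ^ 'd. \<chi> k. case k of None \<Rightarrow> 0 | Some i \<Rightarrow> y $ i)"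
  define cut where "cut = (\<lambda>x::real ^ 'd option. \<chi> i. x $ Some i)"
  have padcut: "pad (cut x) = x" if "x $ None = 0" for x
    using that by (auto simp: pad_def cut_def vec_eq_iff split: option.split)
  have cutpad: "cut (pad y) = y" for y
    by (auto simp: pad_def cut_def vec_eq_iff)
  \<comment> \<open>the basis that corresponds to the unit vectors under \<open>L\<close>\<close>
  define b where "b = (\<lambda>i::'d. J (axis (Some i) 1))"
  have sum_b: "(\<Sum>i\<in>UNIV. y $ i *\<^sub>R b i) = J (pad y)" for y
  proof -
    have "pad y = (\<Sum>i\<in>UNIV. y $ i *\<^sub>R axis (Some i) 1)"
      by (auto simp: pad_def vec_eq_iff axis_def if_distrib cong: if_cong split: option.split)
    then show ?thesis
      by (simp add: b_def linear_sum[OF J] linear_cmul[OF J])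
  qed
  have "is_lattice_basis {x \<in> int_lattice. v \<bullet> x = 0} b"
    unfolding is_lattice_basis_iff sum_b
  proof (rule bij_betwI[where g = "\<lambda>x. cut (L x)"])
    show "(\<lambda>y. J (pad y)) \<in> int_lattice \<rightarrow> {x \<in> int_lattice. v \<bullet> x = 0}"
      by (auto simp: Jint L(2)) (auto simp: pad_def int_lattice_def split: option.split)
    show "(\<lambda>x. cut (L x)) \<in> {x \<in> int_lattice. v \<bullet> x = 0} \<rightarrow> int_lattice"
    proof
      fix x :: "real ^ 'd option" assume "x \<in> {x \<in> int_lattice. v \<bullet> x = 0}"
      then have "L x \<in> int_lattice"
        using int by blast
      then show "cut (L x) \<in> int_lattice"
        by (simp add: cut_def int_lattice_def)
    qed
  qed (auto simp: cutpad padcut L(2))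
  then have "is_lattice_basis {x \<in> int_lattice. v \<bullet> x = 0} (perp_basis v :: 'd \<Rightarrow> _)"
    unfolding perp_basis_def by (rule someI[of _ b])
  then have G: "bij_betw (perp_chart v) int_lattice {x \<in> int_lattice. v \<bullet> x = 0}"
    by (simp add: is_lattice_basis_iff perp_chart_def[abs_def])
  show im: "perp_chart v ` int_lattice = {x \<in> int_lattice. v \<bullet> x = 0}"
    using G by (simp add: bij_betw_def)
  have "perp_basis v i = perp_chart v (axis i 1)" for i :: 'd
    by (simp add: perp_chart_def axis_def if_distrib[of "\<lambda>c. c *\<^sub>R _"] cong: if_cong)
  moreover have "axis i (1::real) \<in> int_lattice" for i :: 'd
    by (simp add: int_lattice_axis)
  ultimately have orth: "v \<bullet> perp_basis v i = 0" for i :: 'd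
    using im by fastforce
  have bG: "b i \<in> range (perp_chart v)" for i
  proof -
    have "b i \<in> {x \<in> int_lattice. v \<bullet> x = 0}"
      by (auto simp: b_def Jint int_lattice_axis L(2)) (simp add: axis_def)
    then show ?thesis
      using im by blast
  qed
  show ran: "range (perp_chart v) = {x. v \<bullet> x = 0}"
  proof (intro equalityI subsetI)
    fix x assume "x \<in> range (perp_chart v)"
    then show "x \<in> {x. v \<bullet> x = 0}"
      by (auto simp: perp_chart_def inner_sum_right orth)
  next
    fix x assume "x \<in> {x. v \<bullet> x = 0}"
    then have "x = (\<Sum>i\<in>UNIV. cut (L x) $ i *\<^sub>R b i)"
      by (simp add: sum_b padcut L(2))
    moreover have "subspace (range (perp_chart v))"
      by (rule linear_subspace_image[OF linear_perp_chart subspace_UNIV])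
    then have "(\<Sum>i\<in>UNIV. cut (L x) $ i *\<^sub>R b i) \<in> range (perp_chart v)"
      by (intro subspace_sum subspace_scale bG)
    ultimately show "x \<in> range (perp_chart v)"
      by simp
  qed
  have "linear cut"
    by (rule linearI) (auto simp: cut_def vec_eq_iff)
  then have lin': "linear (\<lambda>y. cut (L (perp_chart v y)))"
    using linear_compose[OF linear_compose[OF linear_perp_chart lin]] by (simp add: o_def)
  have "surj (\<lambda>y. cut (L (perp_chart v y)))"
  proof (unfold surj_def, intro allI)
    fix y
    have "J (pad y) \<in> range (perp_chart v)"
      by (auto simp: ran L(2) pad_def)
    then obtain z where "perp_chart v z = J (pad y)"
      by auto
    then show "\<exists>z. y = cut (L (perp_chart v z))"
      by (intro exI[of _ z]) (simp add: cutpad)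
  qed
  then have "inj (\<lambda>y. cut (L (perp_chart v y)))"
    by (rule linear_surjective_imp_injective[OF lin' _ refl])
  then show "inj (perp_chart v)"
    by (metis (mono_tags, lifting) injD injI)
qed

section \<open>Lattice automorphisms preserve volume\<close>

lemma det_lattice_map_Ints:
  fixes L :: "real ^ 'd \<Rightarrow> real ^ 'd::finite"
  assumes "L ` int_lattice \<subseteq> int_lattice"
  shows "det (matrix L) \<in> \<int>"
proof -
  have "L (axis j 1) $ i \<in> \<int>" for i j
    using assms int_lattice_axis[of 1 j] by (force simp: int_lattice_def)
  then show ?thesis
    unfolding det_def matrix_def by (auto intro!: Ints_sum Ints_mult Ints_prod)
qed

text \<open>
  The determinants of \<open>L\<close> and of its inverse are integers with product \<open>1\<close>.
\<close>

lemma lattice_automorphism_det: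
  fixes L :: "real ^ 'd \<Rightarrow> real ^ 'd::finite"
  assumes "lattice_automorphism L"
  shows "\<bar>det (matrix L)\<bar> = 1"
proof -
  have lin: "linear L" and bij: "bij L" and int: "L ` int_lattice = int_lattice"
    using assms by (auto simp: lattice_automorphism_def)
  obtain J where J: "linear J" "J \<circ> L = id"
    using linear_injective_left_inverse[OF lin bij_is_inj[OF bij]] by blast
  have "J ` int_lattice = (J \<circ> L) ` int_lattice"
    using int by (metis image_comp)
  then have Jint: "J ` int_lattice \<subseteq> int_lattice"
    by (simp add: J)
  have "matrix J ** matrix L = mat 1"
    using matrix_compose[OF lin J(1)] J(2) by (simp add: matrix_id_mat_1)
  then have "det (matrix J) * det (matrix L) = 1"
    by (metis det_I det_mul)
  moreover have "det (matrix J) \<in> \<int>" "det (matrix L) \<in> \<int>"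
    using det_lattice_map_Ints Jint int by blast+
  ultimately show ?thesis
    using Ints_mult_eq_1[of "det (matrix L)" "det (matrix J)"] by (auto simp: mult.commute)
qed

text \<open>
  The determinant formula for the volume of a linear image refers to a well-ordered index type. A finite type
  carries no canonical order, so its members are replaced by the natural numbers below its cardinality.
\<close>

typedef ('d::finite) ordered_index = "{..<CARD('d)}"
  by (rule exI[of _ 0]) simp

instance ordered_index :: (finite) finite
proof
  have "(UNIV :: 'a ordered_index set) = Abs_ordered_index ` {..<CARD('a)}"
    by (metis type_definition.Abs_image type_definition_ordered_index)
  then show "finite (UNIV :: 'a ordered_index set)"
    by (metis finite_imageI finite_lessThan)
qed

instantiation ordered_index :: (finite) wellorder
begin

definition "x \<le> y \<longleftrightarrow> Rep_ordered_index x \<le> Rep_ordered_index y"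
definition "x < y \<longleftrightarrow> Rep_ordered_index x < Rep_ordered_index y"

instance
proof
  fix P :: "'a ordered_index \<Rightarrow> bool" and a
  assume step: "\<And>x. (\<And>y. y < x \<Longrightarrow> P y) \<Longrightarrow> P x"
  show "P a"
  proof (induction a rule: measure_induct_rule[of Rep_ordered_index])
    case (less x)
    show ?case
      by (rule step, rule less) (simp add: less_ordered_index_def)
  qed
qed (auto simp: less_eq_ordered_index_def less_ordered_index_def Rep_ordered_index_inject)

end

lemma card_ordered_index: "CARD('d::finite ordered_index) = CARD('d)"
  by (metis card_lessThan type_definition.card type_definition_ordered_index)

lemma Basis_vec_eq_range: "(Basis :: (real ^ 'n::finite) set) = range (\<lambda>i. axis i 1)"
  by (auto simp: Basis_vec_def)

lemma lborel_reindex: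
  fixes r :: "'a::finite \<Rightarrow> 'b::finite"
  assumes "bij r"
  shows "distr lborel borel (\<lambda>x::real ^ 'b. \<chi> i. x $ r i) = (lborel :: (real ^ 'a) measure)"
proof (rule lborel_eqI[symmetric])
  let ?R = "\<lambda>x::real ^ 'b. (\<chi> i. x $ r i) :: real ^ 'a"
  have "continuous_on UNIV ?R"
    by (intro continuous_intros)
  then have meas: "?R \<in> borel \<rightarrow>\<^sub>M borel"
    by (rule borel_measurable_continuous_onI)
  fix l u :: "real ^ 'a"
  assume le: "\<And>b. b \<in> Basis \<Longrightarrow> l \<bullet> b \<le> u \<bullet> b"
  define l' u' where "l' = (\<chi> k. l $ inv r k)" and "u' = (\<chi> k. u $ inv r k)"
  have r: "inv r (r i) = i" "r (inv r k) = k" for i k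
    using assms by (simp_all add: bij_is_inj bij_is_surj surj_f_inv_f)
  have le': "l' \<bullet> b \<le> u' \<bullet> b" if b: "b \<in> Basis" for b
  proof -
    obtain k where "b = axis k 1"
      using b by (auto simp: Basis_vec_eq_range)
    then show ?thesis
      using le[of "axis (inv r k) 1"] by (simp add: Basis_vec_eq_range inner_axis l'_def u'_def)
  qed
  have "?R -` box l u = box l' u'"
    by (auto simp: mem_box_cart l'_def u'_def r) (metis r)+
  then have "emeasure (distr lborel borel ?R) (box l u) = emeasure lborel (box l' u')"
    using meas by (simp add: emeasure_distr)
  also have "\<dots> = (\<Prod>b\<in>Basis. (u' - l') \<bullet> b)"
    by (rule emeasure_lborel_box[OF le'])
  also have "(\<Prod>b\<in>Basis. (u' - l') \<bullet> b) = (\<Prod>k\<in>UNIV. u' $ k - l' $ k)"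
    by (simp add: Basis_vec_eq_range prod.reindex inj_on_def axis_eq_axis inner_axis)
  also have "\<dots> = (\<Prod>i\<in>UNIV. u $ i - l $ i)"
    using prod.reindex_bij_betw[OF assms, of "\<lambda>k. u' $ k - l' $ k"] by (simp add: u'_def l'_def r)
  also have "\<dots> = (\<Prod>b\<in>Basis. (u - l) \<bullet> b)"
    by (simp add: Basis_vec_eq_range prod.reindex inj_on_def axis_eq_axis inner_axis)
  finally show "emeasure (distr lborel borel ?R) (box l u) = (\<Prod>b\<in>Basis. (u - l) \<bullet> b)" .
qed simp

lemma emeasure_lattice_automorphism_wellorder:
  fixes L :: "real ^ 'd::{finite,wellorder} \<Rightarrow> real ^ 'd::_"
  assumes "lattice_automorphism L" "compact Y"
  shows "emeasure lborel (L ` Y) = emeasure lborel Y"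
proof -
  have lin: "linear L"
    using assms by (auto simp: lattice_automorphism_def)
  have LY: "compact (L ` Y)"
    by (rule compact_continuous_image[OF linear_continuous_on assms(2)])
       (simp add: linear_conv_bounded_linear[symmetric] lin)
  have "measure lebesgue (L ` Y) = measure lebesgue Y"
    using measure_linear_image[OF lin lmeasurable_compact[OF assms(2)]]
      lattice_automorphism_det[OF assms(1)] by simp
  then have "emeasure lebesgue (L ` Y) = emeasure lebesgue Y"
    using lmeasurable_compact[OF LY] lmeasurable_compact[OF assms(2)]
    by (simp add: emeasure_eq_measure2)
  then show ?thesis
    using LY assms(2) by (simp add: borel_compact)
qed

lemma emeasure_lattice_automorphism:
  fixes L :: "real ^ 'd \<Rightarrow> real ^ 'd::finite"
  assumes L: "lattice_automorphism L" and Y: "compact Y"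
  shows "emeasure lborel (L ` Y) = emeasure lborel Y" "compact (L ` Y)"
proof -
  obtain r :: "'d \<Rightarrow> 'd ordered_index" where r: "bij r"
    using finite_same_card_bij[of "UNIV :: 'd set" "UNIV :: 'd ordered_index set"]
    by (auto simp: card_ordered_index)
  define R where "R = (\<lambda>x::real ^ 'd ordered_index. (\<chi> i. x $ r i) :: real ^ 'd)"
  define Q where "Q = (\<lambda>x::real ^ 'd. (\<chi> k. x $ inv r k) :: real ^ 'd ordered_index)"
  have inv: "inv r (r i) = i" "r (inv r k) = k" for i k
    using r by (simp_all add: bij_is_inj bij_is_surj surj_f_inv_f)
  have RQ: "R (Q x) = x" and QR: "Q (R z) = z" for x z
    by (simp_all add: R_def Q_def vec_eq_iff inv)
  have lin: "linear L" and bij: "bij L" and int: "L ` int_lattice = int_lattice"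
    using L by (auto simp: lattice_automorphism_def)
  have linR: "linear R" "linear Q"
    by (auto intro!: linearI simp: R_def Q_def vec_eq_iff)
  have RQint: "R z \<in> int_lattice \<longleftrightarrow> z \<in> int_lattice" for z
    by (auto simp: R_def int_lattice_def) (metis inv(2))
  have Lint: "L x \<in> int_lattice \<longleftrightarrow> x \<in> int_lattice" for x
    using int bij by (metis bij_is_inj inj_image_mem_iff)
  define L' where "L' = (\<lambda>z. Q (L (R z)))"
  have L': "lattice_automorphism L'"
  proof (rule lattice_automorphismI[where L' = "\<lambda>z. Q (inv L (R z))"])
    show "linear L'"
      using linear_compose[OF linear_compose[OF linR(1) lin] linR(2)] by (simp add: L'_def o_def)
    show "L' (Q (inv L (R z))) = z" "Q (inv L (R (L' z))) = z" for z
      using bij by (simp_all add: L'_def RQ QR bij_is_inj bij_is_surj surj_f_inv_f)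
    show "L' z \<in> int_lattice" if "z \<in> int_lattice" for z
      using that RQint Lint by (metis L'_def RQ)
    show "Q (inv L (R z)) \<in> int_lattice" if "z \<in> int_lattice" for z
      using that RQint Lint bij by (metis RQ bij_is_surj surj_f_inv_f)
  qed
  have compactQ: "compact (Q ` Z)" if "compact Z" for Z
    by (rule compact_continuous_image[OF linear_continuous_on that])
       (simp add: linear_conv_bounded_linear[symmetric] linR)
  have compactL: "compact (L ` Z)" if "compact Z" for Z
    by (rule compact_continuous_image[OF linear_continuous_on that])
       (simp add: linear_conv_bounded_linear[symmetric] lin)
  have "continuous_on UNIV R"
    unfolding R_def by (intro continuous_intros)
  then have meas: "R \<in> borel \<rightarrow>\<^sub>M borel"
    by (rule borel_measurable_continuous_onI)
  have Q: "emeasure lborel Z = emeasure lborel (Q ` Z)" if "compact Z" for Z :: "(real ^ 'd) set"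
  proof -
    have "R -` Z = Q ` Z"
      by (auto simp: RQ) (metis QR image_iff)
    then have "emeasure (distr lborel borel R) Z = emeasure lborel (Q ` Z)"
      using meas that by (simp add: emeasure_distr borel_compact)
    then show ?thesis
      using lborel_reindex[OF r] by (simp add: R_def)
  qed
  show LY: "compact (L ` Y)"
    by (rule compactL[OF Y])
  have "emeasure lborel (L ` Y) = emeasure lborel (L' ` (Q ` Y))"
    by (simp add: Q[OF LY] image_image L'_def RQ)
  also have "\<dots> = emeasure lborel (Q ` Y)"
    by (rule emeasure_lattice_automorphism_wellorder[OF L' compactQ[OF Y]])
  finally show "emeasure lborel (L ` Y) = emeasure lborel Y"
    by (simp add: Q[OF Y])
qed

section \<open>Null sets and finite sums of measures\<close>

lemma emeasure_lborel_translation: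
  fixes Z :: "'a::euclidean_space set"
  assumes "compact Z"
  shows "emeasure lborel ((+) a ` Z) = emeasure lborel Z"
proof -
  have cpt: "compact ((+) a ` Z)"
    by (rule compact_translation[OF assms])
  have "emeasure lborel ((+) a ` Z) = emeasure (distr lborel borel ((+) a)) ((+) a ` Z)"
    by (simp only: lborel_distr_plus)
  also have "\<dots> = emeasure lborel ((+) a -` ((+) a ` Z))"
    using cpt by (simp add: emeasure_distr borel_compact)
  also have "(+) a -` ((+) a ` Z) = Z"
    by (simp add: inj_vimage_image_eq)
  finally show ?thesis .
qed

text \<open>
  The translates of \<open>Z\<close> by \<open>w\<close>, \<open>w/2\<close>, \<open>w/3\<close>, \<dots> are disjoint and have the same volume as \<open>Z\<close>, and all of
  them fit into one ball.
\<close>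

lemma transversal_null:
  fixes Z :: "'a::euclidean_space set"
  assumes Z: "compact Z" and line: "\<And>y t. y \<in> Z \<Longrightarrow> 0 < t \<Longrightarrow> y + t *\<^sub>R w \<notin> Z"
  shows "emeasure lborel Z = 0"
proof -
  define T where "T k = (+) ((1 / real (Suc k)) *\<^sub>R w) ` Z" for k
  obtain K where K: "\<And>y. y \<in> Z \<Longrightarrow> norm y \<le> K"
    using compact_imp_bounded[OF Z] bounded_iff by blast
  define U :: "'a set" where "U = cball 0 (norm w + K)"
  have sub: "T k \<subseteq> U" for k
  proof
    fix x assume "x \<in> T k"
    then obtain y where y: "y \<in> Z" "x = (1 / real (Suc k)) *\<^sub>R w + y"
      by (auto simp: T_def)
    have "norm x \<le> norm ((1 / real (Suc k)) *\<^sub>R w) + norm y"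
      unfolding y(2) by (rule norm_triangle_ineq)
    also have "\<dots> \<le> norm w + K"
    proof (rule add_mono[OF _ K[OF y(1)]])
      show "norm ((1 / real (Suc k)) *\<^sub>R w) \<le> norm w"
        by (simp add: divide_le_eq mult_le_cancel_left1)
    qed
    finally show "x \<in> U"
      by (simp add: U_def)
  qed
  have T: "compact (T k)" "emeasure lborel (T k) = emeasure lborel Z" for k
    using Z by (auto simp: T_def emeasure_lborel_translation compact_translation)
  have disj': "T i \<inter> T j = {}" if "i < j" for i j
  proof (rule ccontr)
    assume "T i \<inter> T j \<noteq> {}"
    then obtain y z where yz: "y \<in> Z" "z \<in> Z"
      "(1 / real (Suc i)) *\<^sub>R w + y = (1 / real (Suc j)) *\<^sub>R w + z"
      unfolding T_def by blast
    have "z = y + (1 / real (Suc i) - 1 / real (Suc j)) *\<^sub>R w"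
      using yz(3) by (simp add: scaleR_left_diff_distrib algebra_simps)
    moreover have "1 / real (Suc i) - 1 / real (Suc j) > 0"
      using that by (simp add: frac_less2)
    ultimately show False
      using line[OF yz(1)] yz(2) by blast
  qed
  then have disj: "disjoint_family_on T I" for I
    unfolding disjoint_family_on_def by (metis Int_commute nat_neq_iff)
  have U_fin: "emeasure lborel U < \<infinity>"
    by (intro emeasure_bounded_finite) (simp add: U_def)
  have bound: "of_nat N * emeasure lborel Z \<le> emeasure lborel U" for N
  proof -
    have "of_nat N * emeasure lborel Z = (\<Sum>k<N. emeasure lborel (T k))"
      by (simp add: T(2))
    also have "\<dots> = emeasure lborel (\<Union>k<N. T k)"
      by (rule sum_emeasure) (use T(1) disj in \<open>auto simp: borel_compact\<close>)
    also have "\<dots> \<le> emeasure lborel U"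
      using sub by (intro emeasure_mono) (auto simp: U_def)
    finally show ?thesis .
  qed
  define e where "e = enn2real (emeasure lborel Z)"
  define u where "u = enn2real (emeasure lborel U)"
  have e: "emeasure lborel Z = ennreal e"
    using emeasure_bounded_finite[OF compact_imp_bounded[OF Z]] by (simp add: e_def)
  have u: "emeasure lborel U = ennreal u"
    using U_fin by (simp add: u_def)
  have nonneg: "0 \<le> e" "0 \<le> u"
    by (simp_all add: e_def u_def)
  have "real N * e \<le> u" for N
  proof -
    have "ennreal (real N * e) \<le> ennreal u"
      using bound[of N] nonneg by (simp add: e u ennreal_mult' ennreal_of_nat_eq_real_of_nat)
    then show ?thesis
      by (simp only: ennreal_le_iff[OF nonneg(2)])
  qed
  then have "\<not> 0 < e"
    by (metis reals_Archimedean3 not_le)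
  then show ?thesis
    using e by (simp add: ennreal_neg)
qed

lemma sum_emeasure_almost_disjoint:
  assumes "finite I" "\<And>i. i \<in> I \<Longrightarrow> A i \<in> sets M"
    and "\<And>i j. i \<in> I \<Longrightarrow> j \<in> I \<Longrightarrow> i \<noteq> j \<Longrightarrow> emeasure M (A i \<inter> A j) = 0"
  shows "(\<Sum>i\<in>I. emeasure M (A i)) = emeasure M (\<Union>i\<in>I. A i)"
  using assms
proof (induction I)
  case (insert k I)
  have U: "(\<Union>i\<in>I. A i) \<in> sets M"
    using insert by auto
  have "emeasure M (\<Union>i\<in>I. A k \<inter> A i) \<le> (\<Sum>i\<in>I. emeasure M (A k \<inter> A i))"
    using insert by (intro emeasure_subadditive_finite) auto
  also have "\<dots> = 0"
    using insert by (intro sum.neutral) auto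
  finally have "emeasure M (A k \<inter> (\<Union>i\<in>I. A i)) = 0"
    by (simp only: Int_UN_distrib le_zero_eq)
  then have "emeasure M (A k \<union> (\<Union>i\<in>I. A i)) = emeasure M (A k) + emeasure M (\<Union>i\<in>I. A i)"
    using emeasure_Un_Int[of "A k" M "\<Union>i\<in>I. A i"] U insert by simp
  then show ?case
    using insert by simp
qed simp

lemma ennreal_add_le_self:
  fixes x y :: ennreal
  assumes "x \<noteq> \<infinity>" "x + y \<le> x"
  shows "y = 0"
proof -
  have "x + y \<le> x + 0"
    using assms(2) by simp
  then have "y \<le> 0"
    using assms(1) by (simp only: ennreal_add_left_cancel_le) simp
  then show ?thesis
    by simp
qed

section \<open>Projections along a lattice vector\<close>

text \<open>
  For \<open>v \<bullet> m = 1\<close>: the coordinates, in the chosen basis of the lattice orthogonal to \<open>v\<close>, of the projection of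
  \<open>x\<close> along \<open>m\<close> onto the hyperplane orthogonal to \<open>v\<close>.
\<close>

definition project_coords :: "real ^ 'd::finite option \<Rightarrow> real ^ 'd option \<Rightarrow> real ^ 'd option \<Rightarrow> real ^ 'd"
  where "project_coords m v x = inv (perp_chart v) (x - (v \<bullet> x) *\<^sub>R m)"

context
  fixes m v :: "real ^ 'd::finite option"
  assumes m: "m \<in> int_lattice" and v: "v \<in> int_lattice" and vm: "v \<bullet> m = 1"
begin

lemma perp_chart_project_coords: "perp_chart v (project_coords m v x) = x - (v \<bullet> x) *\<^sub>R m"
proof -
  have "x - (v \<bullet> x) *\<^sub>R m \<in> range (perp_chart v)"
    using perp_chart(2)[OF v m vm] vm by (simp add: inner_diff_right)
  then show ?thesis
    unfolding project_coords_def by (rule f_inv_into_f)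
qed

lemma project_coords_eqI:
  assumes "perp_chart v p = x - t *\<^sub>R m"
  shows "project_coords m v x = p"
proof -
  have "v \<bullet> perp_chart v p = 0"
    using perp_chart(2)[OF v m vm] by blast
  then have "v \<bullet> x = t"
    using vm by (simp add: assms inner_diff_right)
  then show ?thesis
    unfolding project_coords_def
    using inv_f_f[OF perp_chart(3)[OF v m vm], of p] assms by simp
qed

lemma linear_project_coords: "linear (project_coords m v)"
proof (rule linearI)
  show "project_coords m v (x + y) = project_coords m v x + project_coords m v y" for x y
    by (rule project_coords_eqI[of _ _ "v \<bullet> x + v \<bullet> y"])
      (simp add: linear_add[OF linear_perp_chart] perp_chart_project_coords scaleR_left_distrib)
  show "project_coords m v (r *\<^sub>R x) = r *\<^sub>R project_coords m v x" for r x
    by (rule project_coords_eqI[of _ _ "r * (v \<bullet> x)"])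
      (simp add: linear_cmul[OF linear_perp_chart] perp_chart_project_coords scaleR_right_diff_distrib)
qed

lemma project_coords_int:
  assumes "x \<in> int_lattice"
  shows "project_coords m v x \<in> int_lattice"
proof -
  have "x - (v \<bullet> x) *\<^sub>R m \<in> {x \<in> int_lattice. v \<bullet> x = 0}"
    using assms m v vm
    by (auto simp: inner_diff_right intro!: int_lattice_diff int_lattice_scaleR inner_int_lattice)
  then obtain p where "p \<in> int_lattice" "x - (v \<bullet> x) *\<^sub>R m = perp_chart v p"
    unfolding perp_chart(1)[OF v m vm, symmetric] by blast
  then show ?thesis
    using project_coords_eqI by metis
qed

end

text \<open>
  Both hyperplanes are complements of \<open>m\<close>, also on the level of lattices, and the projections along \<open>m\<close> between
  them are inverse to each other.
\<close>

lemma lattice_automorphism_project_coords: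
  assumes m: "m \<in> int_lattice" and v: "v \<in> int_lattice" "v \<bullet> m = 1" and w: "w \<in> int_lattice" "w \<bullet> m = 1"
  shows "lattice_automorphism (\<lambda>y. project_coords m v (perp_chart w y))"
proof (rule lattice_automorphismI[where L' = "\<lambda>y. project_coords m w (perp_chart v y)"])
  show "linear (\<lambda>y. project_coords m v (perp_chart w y))"
    using linear_compose[OF linear_perp_chart linear_project_coords[OF m v]] by (simp add: o_def)
  show "project_coords m v (perp_chart w (project_coords m w (perp_chart v x))) = x" for x
    by (rule project_coords_eqI[OF m v, of _ _ "- (w \<bullet> perp_chart v x)"])
      (simp add: perp_chart_project_coords[OF m w])
  show "project_coords m w (perp_chart v (project_coords m v (perp_chart w x))) = x" for x
    by (rule project_coords_eqI[OF m w, of _ _ "- (v \<bullet> perp_chart w x)"])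
      (simp add: perp_chart_project_coords[OF m v])
  show "project_coords m v (perp_chart w x) \<in> int_lattice" if "x \<in> int_lattice" for x
    using perp_chart(1)[OF w(1) m w(2)] that by (intro project_coords_int[OF m v]) blast
  show "project_coords m w (perp_chart v x) \<in> int_lattice" if "x \<in> int_lattice" for x
    using perp_chart(1)[OF v(1) m v(2)] that by (intro project_coords_int[OF m w]) blast
qed

text \<open>
  The coordinates \<open>beta\<close> are adjoint to the chart, so a subgradient \<open>p\<close> in coordinates stands for the vector
  \<open>perp_chart (outer_normal \<Delta> \<sigma>) p\<close>.
\<close>

lemma inner_beta: "p \<bullet> beta \<Delta> \<sigma> n = perp_chart (outer_normal \<Delta> \<sigma>) p \<bullet> n"
  by (simp add: beta_def inner_vec_def[of p] perp_chart_def inner_sum_left)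

section \<open>Polytopes with unimodular facet normals\<close>

definition facet_chart ::
  "(real ^ 'd::finite option) set \<Rightarrow> (real ^ 'd option) set \<Rightarrow> real ^ 'd \<Rightarrow> real ^ 'd option" where
  "facet_chart P F y = (SOME p. p \<in> F) + perp_chart (outer_normal P F) y"

lemma facet_measure_eq_distr: "facet_measure P F = distr lborel borel (facet_chart P F)"
  by (simp add: facet_measure_def facet_chart_def[abs_def] perp_chart_def)

lemma continuous_perp_chart: "continuous_on X (perp_chart v)"
  by (rule linear_continuous_on) (simp add: linear_conv_bounded_linear[symmetric] linear_perp_chart)

lemma continuous_facet_chart: "continuous_on X (facet_chart P F)"
  unfolding facet_chart_def[abs_def] by (intro continuous_intros continuous_perp_chart)

lemma facet_chart_measurable [measurable]: "facet_chart P F \<in> borel \<rightarrow>\<^sub>M borel"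
  by (rule borel_measurable_continuous_onI[OF continuous_facet_chart])

lemma emeasure_facet_measure:
  "X \<in> sets borel \<Longrightarrow> emeasure (facet_measure P F) X = emeasure lborel (facet_chart P F -` X)"
  by (simp add: facet_measure_eq_distr emeasure_distr)

text \<open>
  The common shape of \<open>\<Delta>\<close>, with right-hand sides \<open>c = 1\<close>, and of \<open>\<Delta>\<^sub>h\<close>, with right-hand sides \<open>c = h\<close>. The vectors
  in \<open>S\<close> may include some that define no facet. A lattice vector \<open>u\<close> with \<open>a \<bullet> u = 1\<close> makes \<open>a\<close> primitive
  and its orthogonal lattice a direct summand.
\<close>

locale lattice_normal_polytope =
  fixes P :: "(real ^ 'd::finite option) set" and S :: "(real ^ 'd option) set"
    and c :: "real ^ 'd option \<Rightarrow> real"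
  assumes finite_normals: "finite S"
    and bounded: "bounded P"
    and halfspaces: "P = {x. \<forall>a\<in>S. a \<bullet> x \<le> c a}"
    and pos: "\<And>a. a \<in> S \<Longrightarrow> 0 < c a"
    and int: "S \<subseteq> int_lattice"
    and unimodular: "\<And>a. a \<in> S \<Longrightarrow> \<exists>u\<in>int_lattice. a \<bullet> u = 1"
begin

lemma interiorI:
  assumes "\<And>a. a \<in> S \<Longrightarrow> a \<bullet> x < c a"
  shows "x \<in> interior P"
proof (rule interiorI)
  have "{x. \<forall>a\<in>S. a \<bullet> x < c a} = (\<Inter>a\<in>S. {x. a \<bullet> x < c a})"
    by blast
  then show "open {x. \<forall>a\<in>S. a \<bullet> x < c a}"
    using finite_normals by (simp add: open_INT open_halfspace_lt)
  show "{x. \<forall>a\<in>S. a \<bullet> x < c a} \<subseteq> P"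
    by (auto simp: halfspaces less_imp_le)
qed (use assms in auto)

lemma zero_in_interior: "0 \<in> interior P"
  by (rule interiorI) (simp add: pos)

lemma polyhedron: "polyhedron P"
proof -
  have "P = \<Inter>((\<lambda>a. {x. a \<bullet> x \<le> c a}) ` S)"
    by (auto simp: halfspaces)
  moreover have "polyhedron (\<Inter>((\<lambda>a. {x. a \<bullet> x \<le> c a}) ` S))"
    using finite_normals by (intro polyhedron_Inter) (auto simp: polyhedron_halfspace_le)
  ultimately show ?thesis
    by simp
qed

lemma polytope: "polytope P"
  using polytope_eq_bounded_polyhedron polyhedron bounded by blast

lemma convex: "convex P" and closed: "closed P" and compact: "compact P"
  by (rule polytope_imp_convex[OF polytope], rule polytope_imp_closed[OF polytope],
      rule polytope_imp_compact[OF polytope])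

lemma aff_dim: "aff_dim P = int CARD('d) + 1"
proof -
  have "affine hull P = UNIV"
    using zero_in_interior by (intro affine_hull_nonempty_interior) auto
  then show ?thesis
    by (simp add: aff_dim_eq_full[symmetric])
qed

lemma finite_facets: "finite {F. F facet_of P}"
  by (rule finite_polytope_facets[OF polytope])

lemma frontier_eq_facets: "frontier P = \<Union>{F. F facet_of P}"
proof -
  have "rel_interior P = interior P"
    using zero_in_interior by (intro rel_interior_nonempty_interior) auto
  then show ?thesis
    using rel_boundary_of_polyhedron[OF polyhedron] closed by (simp add: frontier_def)
qed

lemma facet_subset_frontier: "F facet_of P \<Longrightarrow> F \<subseteq> frontier P"
  using frontier_eq_facets by blast

lemma facet_polytope: "F facet_of P \<Longrightarrow> polytope F"
  by (rule face_of_polytope_polytope[OF polytope facet_of_imp_face_of])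

lemma facet_compact: "F facet_of P \<Longrightarrow> compact F"
  by (rule polytope_imp_compact[OF facet_polytope])

lemma facet_convex: "F facet_of P \<Longrightarrow> convex F"
  by (rule polytope_imp_convex[OF facet_polytope])

lemma facet_nonempty: "F facet_of P \<Longrightarrow> F \<noteq> {}"
  by (simp add: facet_of_def)

lemma facet_maximal:
  assumes F: "F facet_of P" and G: "G face_of P" "G \<noteq> P" and sub: "F \<subseteq> G"
  shows "F = G"
proof (rule ccontr)
  assume "F \<noteq> G"
  have "F face_of G"
    by (rule face_of_subset[OF facet_of_imp_face_of[OF F] sub face_of_imp_subset[OF G(1)]])
  then have "aff_dim F < aff_dim G"
    using \<open>F \<noteq> G\<close> by (rule face_of_aff_dim_lt[OF face_of_imp_convex[OF G(1)]])
  moreover have "aff_dim G < aff_dim P"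
    using face_of_aff_dim_lt[OF convex G] .
  ultimately show False
    using F by (simp add: facet_of_def)
qed

lemma facet_proper: "F facet_of P \<Longrightarrow> F \<noteq> P"
  by (auto simp: facet_of_def)

lemma facets_meet_rel_interior:
  assumes "F facet_of P" "G face_of P" "G \<noteq> P" "x \<in> rel_interior F" "x \<in> G"
  shows "F = G"
proof (rule facet_maximal[OF assms(1-3)])
  show "F \<subseteq> G"
    using assms subset_of_face_of[OF assms(2)] facet_of_imp_subset by blast
qed

lemma facets_eqI:
  assumes "F facet_of P" "G facet_of P" "x \<in> rel_interior F" "x \<in> G"
  shows "F = G"
  by (rule facets_meet_rel_interior[OF assms(1) facet_of_imp_face_of facet_proper]) (fact assms)+

lemma tight_face:
  assumes "a \<in> S"
  shows "P \<inter> {x. a \<bullet> x = c a} face_of P" "P \<inter> {x. a \<bullet> x = c a} \<noteq> P"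
proof -
  show "P \<inter> {x. a \<bullet> x = c a} face_of P"
    by (rule face_of_Int_supporting_hyperplane_le[OF convex]) (use assms halfspaces in auto)
  have "0 \<in> P"
    using zero_in_interior interior_subset by blast
  moreover have "0 \<notin> {x. a \<bullet> x = c a}"
    using pos[OF assms] by simp
  ultimately show "P \<inter> {x. a \<bullet> x = c a} \<noteq> P"
    by blast
qed

text \<open>
  A relative interior point of \<open>F\<close> is not interior to \<open>P\<close>, so one of the inequalities is tight there. The face
  defined by it contains \<open>F\<close>, and facets are maximal.
\<close>

lemma facet_tight:
  assumes F: "F facet_of P"
  obtains a where "a \<in> S" "F = P \<inter> {x. a \<bullet> x = c a}"
proof -
  obtain x where x: "x \<in> rel_interior F"
    using rel_interior_eq_empty[OF facet_convex[OF F]] facet_nonempty[OF F] by blast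
  then have "x \<in> F"
    using rel_interior_subset by blast
  moreover have "F \<inter> interior P = {}"
    by (rule face_of_disjoint_interior[OF facet_of_imp_face_of[OF F] facet_proper[OF F]])
  ultimately obtain a where a: "a \<in> S" "\<not> a \<bullet> x < c a"
    using interiorI by blast
  have "x \<in> P"
    using \<open>x \<in> F\<close> F facet_of_imp_subset by blast
  then have "x \<in> P \<inter> {x. a \<bullet> x = c a}"
    using a halfspaces by force
  then have "F = P \<inter> {x. a \<bullet> x = c a}"
    using facets_meet_rel_interior[OF F tight_face[OF a(1)] x] by blast
  then show thesis
    using that a(1) by blast
qed

lemma affine_hull_tight:
  assumes F: "F facet_of P" and a: "a \<in> S" "F = P \<inter> {x. a \<bullet> x = c a}"
  shows "affine hull F = {x. a \<bullet> x = c a}"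
proof (rule affine_dim_equal)
  show "affine {x. a \<bullet> x = c a}"
    by (rule affine_hyperplane)
  then show "affine hull F \<subseteq> {x. a \<bullet> x = c a}"
    using a(2) by (intro hull_minimal) auto
  have "a \<noteq> 0"
    using unimodular[OF a(1)] by auto
  then show "aff_dim (affine hull F) = aff_dim {x. a \<bullet> x = c a}"
    using F aff_dim by (simp add: facet_of_def)
qed (use facet_nonempty[OF F] in auto)

text \<open>
  A second primitive normal \<open>v\<close> is constant on the hyperplane spanned by \<open>F\<close>, so \<open>v = (v \<bullet> u) a\<close> with an integer
  factor \<open>v \<bullet> u\<close>, which is nonnegative since \<open>0 \<in> P\<close>. As \<open>v\<close> is primitive, the factor is \<open>1\<close>.
\<close>

lemma outer_normal_tight:
  assumes F: "F facet_of P" and a: "a \<in> S" "F = P \<inter> {x. a \<bullet> x = c a}"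
  shows "outer_normal P F = a"
  unfolding outer_normal_def
proof (rule the_equality)
  obtain u where u: "u \<in> int_lattice" "a \<bullet> u = 1"
    using unimodular[OF a(1)] by blast
  have "k = 1" if "a = real k *\<^sub>R w" "w \<in> int_lattice" for k w
  proof -
    have "real k * (w \<bullet> u) = 1"
      using u(2) that(1) by (metis inner_scaleR_left)
    then show "k = 1"
      using Ints_mult_eq_1[of "real k" "w \<bullet> u"] inner_int_lattice[OF that(2) u(1)] by auto
  qed
  then have "primitive a"
    using a(1) int u by (auto simp: primitive_def)
  then show "primitive a \<and> (\<exists>r. P \<subseteq> {x. a \<bullet> x \<le> r} \<and> F = P \<inter> {x. a \<bullet> x = r})"
    using a halfspaces by (intro conjI exI[of _ "c a"]) auto
  fix v
  assume "primitive v \<and> (\<exists>r. P \<subseteq> {x. v \<bullet> x \<le> r} \<and> F = P \<inter> {x. v \<bullet> x = r})"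
  then obtain r where v: "primitive v" and r: "P \<subseteq> {x. v \<bullet> x \<le> r}" "F = P \<inter> {x. v \<bullet> x = r}"
    by blast
  have hyp: "{x. a \<bullet> x = c a} \<subseteq> {x. v \<bullet> x = r}"
    unfolding affine_hull_tight[OF F a, symmetric]
    using r(2) by (intro hull_minimal affine_hyperplane) auto
  have r_eq: "r = c a * (v \<bullet> u)"
    using subsetD[OF hyp, of "c a *\<^sub>R u"] u(2) by simp
  have "(v - (v \<bullet> u) *\<^sub>R a) \<bullet> y = 0" for y
  proof -
    have "v \<bullet> (y + (c a - a \<bullet> y) *\<^sub>R u) = r"
      using u(2) by (intro subsetD[OF hyp, simplified]) (simp add: inner_add_right)
    then show ?thesis
      by (simp add: r_eq inner_add_right inner_diff_left algebra_simps)
  qed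
  then have v_eq: "v = (v \<bullet> u) *\<^sub>R a"
    by (metis all_zero_iff right_minus_eq)
  have "0 \<in> P"
    using zero_in_interior interior_subset by blast
  then have "0 \<le> c a * (v \<bullet> u)"
    using r(1) r_eq by auto
  then have "0 \<le> v \<bullet> u"
    using pos[OF a(1)] by (simp add: zero_le_mult_iff)
  moreover have "v \<bullet> u \<in> \<int>"
    using v u(1) inner_int_lattice by (auto simp: primitive_def)
  ultimately obtain k :: nat where k: "v \<bullet> u = real k"
    by (metis Ints_cases of_int_0_le_iff of_int_of_nat_eq zero_le_imp_eq_int)
  then have "k = 1"
    using v v_eq a(1) int by (metis primitive_def subsetD)
  then show "v = a"
    using v_eq k by simp
qed

lemma outer_normal:
  assumes F: "F facet_of P"
  shows "outer_normal P F \<in> S"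
    and "F = P \<inter> {x. outer_normal P F \<bullet> x = c (outer_normal P F)}"
    and "affine hull F = {x. outer_normal P F \<bullet> x = c (outer_normal P F)}"
proof -
  obtain a where a: "a \<in> S" "F = P \<inter> {x. a \<bullet> x = c a}"
    using facet_tight[OF F] .
  note eq = outer_normal_tight[OF F a]
  show "outer_normal P F \<in> S" "F = P \<inter> {x. outer_normal P F \<bullet> x = c (outer_normal P F)}"
    "affine hull F = {x. outer_normal P F \<bullet> x = c (outer_normal P F)}"
    unfolding eq by (fact a affine_hull_tight[OF F a])+
qed

lemma mem_facet_iff:
  assumes "F facet_of P"
  shows "x \<in> F \<longleftrightarrow> x \<in> P \<and> outer_normal P F \<bullet> x = c (outer_normal P F)"
  using arg_cong[OF outer_normal(2)[OF assms], of "\<lambda>X. x \<in> X"] by simp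

text \<open>
  The ray in direction \<open>w\<close> leaves \<open>P\<close> through such a facet.
\<close>

lemma facet_in_direction:
  assumes "w \<noteq> 0"
  obtains F where "F facet_of P" "0 < outer_normal P F \<bullet> w"
proof -
  obtain t where t: "0 < t" "0 + t *\<^sub>R w \<in> frontier P"
    using ray_to_frontier[OF bounded zero_in_interior assms] by blast
  then obtain F where F: "F facet_of P" "t *\<^sub>R w \<in> F"
    using frontier_eq_facets by auto
  then have "outer_normal P F \<bullet> (t *\<^sub>R w) = c (outer_normal P F)"
    using outer_normal(2)[OF F(1)] by blast
  then have "0 < t * (outer_normal P F \<bullet> w)"
    using pos[OF outer_normal(1)[OF F(1)]] by simp
  then show thesis
    using that F(1) t(1) zero_less_mult_pos by blast
qed

lemma perp_chart_facet:
  assumes F: "F facet_of P"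
  shows "perp_chart (outer_normal P F) ` int_lattice = {x \<in> int_lattice. outer_normal P F \<bullet> x = 0}"
    and "range (perp_chart (outer_normal P F)) = {x. outer_normal P F \<bullet> x = 0}"
    and "inj (perp_chart (outer_normal P F))"
proof -
  obtain u where u: "u \<in> int_lattice" "outer_normal P F \<bullet> u = 1"
    using unimodular[OF outer_normal(1)[OF F]] by blast
  note perp = perp_chart[OF subsetD[OF int outer_normal(1)[OF F]] u]
  show "perp_chart (outer_normal P F) ` int_lattice = {x \<in> int_lattice. outer_normal P F \<bullet> x = 0}"
    "range (perp_chart (outer_normal P F)) = {x. outer_normal P F \<bullet> x = 0}"
    "inj (perp_chart (outer_normal P F))"
    by (fact perp)+
qed

lemma base_point: "F facet_of P \<Longrightarrow> (SOME p. p \<in> F) \<in> F"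
  using facet_nonempty by (simp add: some_in_eq)

lemma range_facet_chart:
  assumes F: "F facet_of P"
  shows "range (facet_chart P F) = affine hull F"
proof -
  let ?n = "outer_normal P F" and ?p = "SOME p. p \<in> F"
  have p: "?n \<bullet> ?p = c ?n"
    using base_point[OF F] outer_normal(2)[OF F] by blast
  have "range (facet_chart P F) = (+) ?p ` {x. ?n \<bullet> x = 0}"
    unfolding perp_chart_facet(2)[OF F, symmetric] image_image by (simp add: facet_chart_def)
  also have "\<dots> = {x. ?n \<bullet> x = c ?n}"
  proof (intro equalityI subsetI)
    fix x assume "x \<in> {x. ?n \<bullet> x = c ?n}"
    then show "x \<in> (+) ?p ` {x. ?n \<bullet> x = 0}"
      using p by (intro image_eqI[of _ _ "x - ?p"]) (auto simp: inner_diff_right)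
  qed (use p in \<open>auto simp: inner_add_right\<close>)
  finally show ?thesis
    by (simp only: outer_normal(3)[OF F])
qed

lemma inj_facet_chart: "F facet_of P \<Longrightarrow> inj (facet_chart P F)"
  using perp_chart_facet(3) by (auto simp: facet_chart_def inj_def)

lemma bounded_chart_vimage:
  assumes F: "F facet_of P" and X: "bounded X"
  shows "bounded (facet_chart P F -` X)"
proof -
  let ?G = "perp_chart (outer_normal P F)" and ?p = "SOME p. p \<in> F"
  obtain B where B: "B > 0" "\<And>y. B * norm y \<le> norm (?G y)"
    using linear_inj_bounded_below_pos[OF linear_perp_chart perp_chart_facet(3)[OF F]]
    by blast
  obtain K where K: "\<And>x. x \<in> X \<Longrightarrow> norm x \<le> K"
    using X bounded_iff by blast
  have "norm y \<le> (K + norm ?p) / B" if "facet_chart P F y \<in> X" for y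
  proof -
    have "B * norm y \<le> norm (facet_chart P F y - ?p)"
      using B(2) by (simp add: facet_chart_def)
    also have "\<dots> \<le> K + norm ?p"
      using K[OF that] norm_triangle_ineq4[of "facet_chart P F y" ?p] by linarith
    finally show ?thesis
      using B(1) by (simp add: field_simps)
  qed
  then show ?thesis
    by (intro boundedI) auto
qed

lemma compact_chart_vimage:
  assumes "F facet_of P" "compact X"
  shows "compact (facet_chart P F -` X)"
  unfolding compact_eq_bounded_closed
  using bounded_chart_vimage[OF assms(1) compact_imp_bounded[OF assms(2)]]
    continuous_closed_vimage[OF compact_imp_closed[OF assms(2)], of "facet_chart P F"]
    continuous_facet_chart[of UNIV P F] by (simp add: continuous_on_eq_continuous_at)

lemma image_chart_vimage:
  assumes "F facet_of P" "X \<subseteq> F"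
  shows "facet_chart P F ` (facet_chart P F -` X) = X"
proof -
  have "X \<subseteq> range (facet_chart P F)"
    unfolding range_facet_chart[OF assms(1)] using assms(2) hull_subset by (rule subset_trans)
  then show ?thesis
    by (simp add: image_vimage_eq Int_absorb2)
qed

lemma chart_vimage_rel_interior:
  assumes F: "F facet_of P"
  shows "facet_chart P F -` rel_interior F = interior (facet_chart P F -` F)"
    and "convex (facet_chart P F -` F)"
proof -
  let ?G = "perp_chart (outer_normal P F)" and ?p = "SOME p. p \<in> F"
  let ?C = "facet_chart P F -` F"
  have lin: "linear ?G" and inj: "inj ?G"
    by (rule linear_perp_chart, rule perp_chart_facet(3)[OF F])
  have chart: "facet_chart P F ` X = (+) ?p ` (?G ` X)" for X
    by (simp add: facet_chart_def image_image)
  have F_eq: "F = (+) ?p ` (?G ` ?C)"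
    using image_chart_vimage[OF F subset_refl] by (simp only: chart)
  have "?C = ?G -` ((+) (- ?p) ` F)"
    by (auto simp: facet_chart_def image_iff) (metis add.commute add_diff_cancel_right' diff_conv_add_uminus)
  then show convex: "convex ?C"
    using facet_convex[OF F] by (simp add: convex_linear_vimage lin)
  have "aff_dim F = aff_dim ?C"
    by (subst F_eq) (simp add: aff_dim_translation_eq aff_dim_injective_linear_image[OF lin inj])
  then have "aff_dim ?C = int CARD('d)"
    using F aff_dim by (simp add: facet_of_def)
  then have "rel_interior ?C = interior ?C"
    by (intro rel_interior_interior) (simp add: aff_dim_eq_full[symmetric])
  moreover have "rel_interior F = facet_chart P F ` rel_interior ?C"
    by (subst F_eq) (simp add: rel_interior_translation
        rel_interior_injective_linear_image[OF _ inj] chart linear_conv_bounded_linear[symmetric] lin)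
  ultimately show "facet_chart P F -` rel_interior F = interior ?C"
    using inj_facet_chart[OF F] by (simp add: inj_vimage_image_eq)
qed

lemma sets_facet [measurable]: "F facet_of P \<Longrightarrow> F \<in> sets borel"
  by (rule borel_compact[OF facet_compact])

lemma sets_rel_interior_facet [measurable]:
  assumes "F facet_of P" shows "rel_interior F \<in> sets borel"
proof -
  obtain W where "open W" "rel_interior F = affine hull F \<inter> W"
    using openin_rel_interior[of F] unfolding openin_open by blast
  then show ?thesis
    by (simp add: borel_closed borel_open sets.Int)
qed

lemma emeasure_boundary_charts:
  assumes "X \<in> sets borel"
  shows "emeasure (boundary_measure P) X =
    (\<Sum>F | F facet_of P. emeasure lborel (facet_chart P F -` (X \<inter> F)))"
  unfolding emeasure_boundary_measure[OF polytope assms]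
  by (rule sum.cong) (auto simp: emeasure_facet_measure assms sets.Int sets_facet)

lemma emeasure_boundary_finite: "emeasure (boundary_measure P) X < \<infinity>"
proof (cases "X \<in> sets borel")
  case True
  have "emeasure lborel (facet_chart P F -` (X \<inter> F)) < \<infinity>" if F: "F facet_of P" for F
    using bounded_chart_vimage[OF F, of "X \<inter> F"] facet_compact[OF F]
    by (intro emeasure_bounded_finite) (auto intro: bounded_subset compact_imp_bounded)
  then show ?thesis
    unfolding emeasure_boundary_charts[OF True] by (auto simp: finite_facets)
next
  case False
  then show ?thesis
    by (simp add: emeasure_notin_sets)
qed

text \<open>
  In the chart of any facet \<open>G\<close> the set lies in the frontier of the convex set that represents \<open>G\<close>.
\<close>

lemma emeasure_facet_boundary:
  assumes F: "F facet_of P"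
  shows "emeasure (boundary_measure P) (F - rel_interior F) = 0"
proof -
  have null: "emeasure lborel (facet_chart P G -` ((F - rel_interior F) \<inter> G)) = 0"
    if G: "G facet_of P" for G
  proof -
    let ?C = "facet_chart P G -` G"
    have "(F - rel_interior F) \<inter> G \<subseteq> G - rel_interior G"
      using facets_eqI[OF G F] by blast
    then have "facet_chart P G -` ((F - rel_interior F) \<inter> G) \<subseteq> frontier ?C"
      using chart_vimage_rel_interior(1)[OF G] closure_subset[of ?C] by (auto simp: frontier_def)
    moreover have "negligible (frontier ?C)"
      by (rule negligible_convex_frontier[OF chart_vimage_rel_interior(2)[OF G]])
    ultimately have "negligible (facet_chart P G -` ((F - rel_interior F) \<inter> G))"
      by (rule negligible_subset[rotated])
    moreover have "facet_chart P G -` ((F - rel_interior F) \<inter> G) \<in> sets borel"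
      using measurable_sets_borel[OF facet_chart_measurable, of "(F - rel_interior F) \<inter> G" P G]
        F G by (simp add: sets.Int sets.Diff sets_facet sets_rel_interior_facet)
    ultimately show ?thesis
      by (simp add: negligible_iff_emeasure0)
  qed
  show ?thesis
    using F null by (subst emeasure_boundary_charts) (auto simp: sets.Diff sets_facet sets_rel_interior_facet)
qed

lemma emeasure_open_facet_pos:
  assumes F: "F facet_of P" and W: "open W" and ne: "W \<inter> F \<noteq> {}"
  shows "emeasure (boundary_measure P) (W \<inter> rel_interior F) > 0"
proof -
  have "F \<subseteq> closure (rel_interior F)"
    using convex_closure_rel_interior[OF facet_convex[OF F]] closure_subset by blast
  then obtain x where x: "x \<in> W" "x \<in> rel_interior F"
    using W ne open_Int_closure_eq_empty[OF W, of "rel_interior F"] by blast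
  then have "x \<in> affine hull F"
    using rel_interior_subset[of F] hull_subset[of F affine] by blast
  then obtain y where y: "x = facet_chart P F y"
    using range_facet_chart[OF F] by blast
  let ?V = "facet_chart P F -` (W \<inter> rel_interior F)"
  have "open (facet_chart P F -` W)"
    using open_vimage[OF W continuous_facet_chart] by blast
  then have "open ?V"
    using chart_vimage_rel_interior(1)[OF F] by (simp add: vimage_Int open_Int)
  moreover have "?V \<noteq> {}"
    using x y by blast
  ultimately have "\<not> negligible ?V"
    using open_not_negligible by blast
  moreover have "?V \<in> sets borel"
    using \<open>open ?V\<close> by (rule borel_open)
  ultimately have "emeasure lborel ?V \<noteq> 0"
    by (simp add: negligible_iff_emeasure0)
  then have "0 < emeasure lborel ?V"
    by (simp add: zero_less_iff_neq_zero)
  also have "?V = facet_chart P F -` ((W \<inter> rel_interior F) \<inter> F)"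
    using rel_interior_subset[of F] by blast
  also have "emeasure lborel \<dots> \<le>
      (\<Sum>G | G facet_of P. emeasure lborel (facet_chart P G -` ((W \<inter> rel_interior F) \<inter> G)))"
    using F finite_facets by (intro member_le_sum) auto
  also have "\<dots> = emeasure (boundary_measure P) (W \<inter> rel_interior F)"
    using W F by (subst emeasure_boundary_charts) (auto simp: sets.Int sets_rel_interior_facet)
  finally show ?thesis .
qed

lemma boundary_pos: "emeasure (boundary_measure P) (frontier P) \<noteq> 0"
proof -
  obtain F where F: "F facet_of P"
    using facet_in_direction[of "axis None 1"] by (metis axis_eq_0_iff zero_neq_one)
  then have "0 < emeasure (boundary_measure P) (UNIV \<inter> rel_interior F)"
    using facet_nonempty by (intro emeasure_open_facet_pos) auto
  also have "\<dots> \<le> emeasure (boundary_measure P) (frontier P)"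
    using facet_subset_frontier[OF F] rel_interior_subset[of F] by (intro emeasure_mono) auto
  finally show ?thesis
    by simp
qed

end

section \<open>Reflexive polytopes and contact points\<close>

lemma finite_bounded_int_lattice:
  fixes X :: "(real ^ 'n::finite) set"
  assumes "bounded X"
  shows "finite (X \<inter> int_lattice)"
proof -
  obtain K where K: "\<And>x. x \<in> X \<Longrightarrow> norm x \<le> K"
    using assms bounded_iff by blast
  let ?I = "real_of_int ` {- \<lceil>K\<rceil>..\<lceil>K\<rceil>}"
  have "x $ i \<in> ?I" if x: "x \<in> X \<inter> int_lattice" for x i
  proof -
    obtain k where k: "x $ i = of_int k"
      using x by (auto simp: int_lattice_def elim: Ints_cases)
    have "\<bar>x $ i\<bar> \<le> K"
      using K[of x] x component_le_norm_cart[of x i] by auto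
    then have "k \<in> {- \<lceil>K\<rceil>..\<lceil>K\<rceil>}"
      using k by (auto simp: abs_le_iff) linarith+
    then show ?thesis
      using k by blast
  qed
  then have "X \<inter> int_lattice \<subseteq> vec_lambda ` (\<Pi>\<^sub>E i\<in>UNIV. ?I)"
    by (intro subsetI) (rule image_eqI[of _ _ "\<lambda>i. _ $ i"]; auto)
  moreover have "finite (\<Pi>\<^sub>E i\<in>(UNIV :: 'n set). ?I)"
    by (intro finite_PiE) auto
  ultimately show ?thesis
    using finite_surj by blast
qed

text \<open>
  The Hahn--Banach extension by one dimension: with \<open>D\<close> the excess of \<open>\<Psi>\<close> over the affine function, every slope
  \<open>D w / (m \<bullet> w)\<close> with \<open>m \<bullet> w < 0\<close> is at most every slope with \<open>m \<bullet> v > 0\<close>, because a convex combination of \<open>v\<close>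
  and \<open>w\<close> is in the hyperplane. Any \<open>s\<close> between the two families works.
\<close>

lemma lift_subgradient:
  fixes \<Psi> :: "'a::euclidean_space \<Rightarrow> real"
  assumes convex: "convex_on UNIV \<Psi>"
    and hyp: "\<And>v. m \<bullet> v = 0 \<Longrightarrow> \<Psi> (n + v) \<ge> \<Psi> n + x \<bullet> v"
  shows "\<exists>s. \<forall>v. \<Psi> (n + v) \<ge> \<Psi> n + (x + s *\<^sub>R m) \<bullet> v"
proof (cases "m = 0")
  case False
  define D where "D v = \<Psi> (n + v) - \<Psi> n - x \<bullet> v" for v
  have cross: "D w / (m \<bullet> w) \<le> D v / (m \<bullet> v)" if v: "m \<bullet> v > 0" and w: "m \<bullet> w < 0" for v w
  proof -
    define a b where "a = m \<bullet> v" and "b = - (m \<bullet> w)"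
    have ab: "a > 0" "b > 0"
      using v w by (auto simp: a_def b_def)
    define p q where "p = b / (a + b)" and "q = a / (a + b)"
    have pq: "0 \<le> p" "0 \<le> q" "p + q = 1"
      using ab by (auto simp: p_def q_def add_divide_distrib[symmetric])
    define z where "z = p *\<^sub>R v + q *\<^sub>R w"
    have "m \<bullet> z = p * a - q * b"
      by (simp add: z_def a_def b_def inner_add_right)
    also have "\<dots> = 0"
      by (simp add: p_def q_def)
    finally have "D z \<ge> 0"
      using hyp[of z] by (simp add: D_def)
    moreover have "n + z = p *\<^sub>R (n + v) + q *\<^sub>R (n + w)"
    proof -
      have "p *\<^sub>R n + q *\<^sub>R n = n"
        using pq(3) by (metis scaleR_left_distrib scaleR_one)
      then show ?thesis
        by (simp add: z_def algebra_simps)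
    qed
    then have le: "\<Psi> (n + z) \<le> p * \<Psi> (n + v) + q * \<Psi> (n + w)"
      using convex pq by (simp add: convex_on_def)
    then have "D z \<le> p * D v + q * D w"
    proof -
      have eq: "p * \<Psi> n + q * \<Psi> n = \<Psi> n"
        using pq(3) by (metis distrib_right mult_1)
      show ?thesis
        using le eq by (simp add: D_def z_def inner_add_right right_diff_distrib)
    qed
    ultimately have "0 \<le> (a + b) * (p * D v + q * D w)"
      using ab by simp
    also have "\<dots> = b * D v + a * D w"
      using ab by (simp add: p_def q_def divide_simps)
    finally have "- (D w / b) \<le> D v / a"
      using ab by (simp add: field_simps)
    then show ?thesis
      by (simp add: a_def b_def)
  qed
  define s where "s = (SUP w\<in>{w. m \<bullet> w < 0}. D w / (m \<bullet> w))"
  have pm: "m \<bullet> m > 0" "m \<bullet> (- m) < 0"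
    using False by auto
  have bdd: "bdd_above ((\<lambda>w. D w / (m \<bullet> w)) ` {w. m \<bullet> w < 0})"
    using cross[OF pm(1)] by (intro bdd_aboveI[of _ "D m / (m \<bullet> m)"]) auto
  have "s * (m \<bullet> v) \<le> D v" for v
  proof (cases "m \<bullet> v" "0 :: real" rule: linorder_cases)
    case less
    then have "D v / (m \<bullet> v) \<le> s"
      unfolding s_def by (intro cSUP_upper[OF _ bdd]) simp
    then show ?thesis
      using less by (simp add: divide_le_eq)
  next
    case equal
    then show ?thesis
      using hyp[of v] by (simp add: D_def)
  next
    case greater
    have "s \<le> D v / (m \<bullet> v)"
      unfolding s_def
    proof (rule cSUP_least)
      show "{w. m \<bullet> w < 0} \<noteq> {}"
        using pm(2) by blast
    qed (use cross[OF greater] in auto)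
    then show ?thesis
      using greater by (simp add: le_divide_eq)
  qed
  then show ?thesis
    by (intro exI[of _ s]) (simp add: D_def inner_add_left algebra_simps)
qed (use hyp in auto)

lemma Ints_pos_le_1: "x \<in> \<int> \<Longrightarrow> 0 < x \<Longrightarrow> x \<le> 1 \<Longrightarrow> x = (1::real)"
  by (auto elim!: Ints_cases)

lemma hull_positive_vertex:
  fixes a :: "real ^ 'n::finite"
  assumes "0 \<in> interior (convex hull V)" "a \<noteq> 0"
  shows "\<exists>v\<in>V. 0 < a \<bullet> v"
proof (rule ccontr)
  assume "\<not> (\<exists>v\<in>V. 0 < a \<bullet> v)"
  then have "convex hull V \<subseteq> {x. a \<bullet> x \<le> 0}"
    by (intro hull_minimal convex_halfspace_le) auto
  moreover obtain e where e: "e > 0" "ball 0 e \<subseteq> convex hull V"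
    using assms(1) mem_interior by blast
  ultimately have "ball 0 e \<subseteq> {x. a \<bullet> x \<le> 0}"
    by blast
  moreover have "(e / 2 / norm a) *\<^sub>R a \<in> ball 0 e"
    using e(1) assms(2) by simp
  ultimately have "a \<bullet> ((e / 2 / norm a) *\<^sub>R a) \<le> 0"
    by blast
  then have "(e / 2 / norm a) * (a \<bullet> a) \<le> 0"
    by (simp only: inner_scaleR_right)
  moreover have "(e / 2 / norm a) * (a \<bullet> a) > 0"
    using e(1) assms(2) by (intro mult_pos_pos divide_pos_pos) auto
  ultimately show False
    by simp
qed

locale reflexive_potential =
  fixes \<Delta> :: "(real ^ 'd::finite option) set" and h :: "real ^ 'd option \<Rightarrow> int"
    and \<Psi> :: "real ^ 'd option \<Rightarrow> real"
  assumes reflexive: "reflexive_polytope \<Delta>"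
    and height: "height_function \<Delta> h"
    and potential: "\<Psi> \<in> PP \<Delta>"
begin

abbreviation dual_height_polytope ("\<Delta>\<^sub>h") where "\<Delta>\<^sub>h \<equiv> dual_h \<Delta> h"

definition dual_normals :: "(real ^ 'd option) set" where
  "dual_normals = dual_polytope \<Delta> \<inter> int_lattice - {0}"

definition lattice_points :: "(real ^ 'd option) set" where
  "lattice_points = \<Delta> \<inter> int_lattice - {0}"

lemma polytope_Delta: "polytope \<Delta>"
  using reflexive by (auto simp: reflexive_polytope_def lattice_polytope_def polytope_def)

lemma zero_in_Delta: "0 \<in> interior \<Delta>" "0 \<in> \<Delta>"
  using reflexive interior_subset[of \<Delta>] by (auto simp: reflexive_polytope_def)

text \<open>
  The bipolar theorem, with the dual polytope replaced by the lattice points that generate it.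
\<close>

lemma Delta_eq_halfspaces: "\<Delta> = {x. \<forall>a\<in>dual_normals. a \<bullet> x \<le> 1}"
proof (intro equalityI subsetI)
  fix x assume x: "x \<in> {x. \<forall>a\<in>dual_normals. a \<bullet> x \<le> 1}"
  obtain V where V: "V \<subseteq> int_lattice" "dual_polytope \<Delta> = convex hull V"
    using reflexive by (auto simp: reflexive_polytope_def lattice_polytope_def)
  have "a \<bullet> x \<le> 1" if a: "a \<in> V" for a
  proof (cases "a = 0")
    case False
    moreover have "V \<subseteq> dual_polytope \<Delta>"
      unfolding V(2) by (rule hull_subset)
    ultimately have "a \<in> dual_normals"
      using a V(1) by (auto simp: dual_normals_def)
    then show ?thesis
      using x by blast
  qed simp
  then have "convex hull V \<subseteq> {a. x \<bullet> a \<le> 1}"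
    by (intro hull_minimal convex_halfspace_le) (auto simp: inner_commute)
  then have le: "x \<bullet> a \<le> 1" if "a \<in> dual_polytope \<Delta>" for a
    using that V(2) by blast
  show "x \<in> \<Delta>"
  proof (rule ccontr)
    assume "x \<notin> \<Delta>"
    then obtain w b where w: "w \<bullet> x < b" "\<And>y. y \<in> \<Delta> \<Longrightarrow> b < w \<bullet> y"
      using separating_hyperplane_closed_point[OF polytope_imp_convex[OF polytope_Delta]
          polytope_imp_closed[OF polytope_Delta]] by blast
    have b: "b < 0"
      using w(2)[OF zero_in_Delta(2)] by simp
    have "y \<bullet> ((1 / b) *\<^sub>R w) \<le> 1" if "y \<in> \<Delta>" for y
      using w(2)[OF that] b by (simp add: divide_le_eq inner_commute)
    then have "(1 / b) *\<^sub>R w \<in> dual_polytope \<Delta>"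
      by (simp add: dual_polytope_def)
    then have "x \<bullet> ((1 / b) *\<^sub>R w) \<le> 1"
      by (rule le)
    then show False
      using w(1) b by (simp add: divide_le_eq inner_commute)
  qed
qed (auto simp: dual_normals_def dual_polytope_def inner_commute)

lemma zero_in_interior_dual: "0 \<in> interior (dual_polytope \<Delta>)"
proof -
  obtain K where K: "K > 0" "\<And>x. x \<in> \<Delta> \<Longrightarrow> norm x \<le> K"
    using polytope_imp_bounded[OF polytope_Delta] bounded_pos by blast
  have "ball 0 (1 / K) \<subseteq> dual_polytope \<Delta>"
  proof
    fix y :: "real ^ 'd option" assume "y \<in> ball 0 (1 / K)"
    then have y: "norm y \<le> 1 / K"
      by simp
    have "x \<bullet> y \<le> 1" if "x \<in> \<Delta>" for x
    proof -
      have "x \<bullet> y \<le> norm x * norm y"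
        by (rule norm_cauchy_schwarz)
      also have "\<dots> \<le> K * (1 / K)"
        using K that y by (intro mult_mono) auto
      finally show ?thesis
        using K(1) by simp
    qed
    then show "y \<in> dual_polytope \<Delta>"
      by (simp add: dual_polytope_def)
  qed
  then show ?thesis
    using K(1) by (meson centre_in_ball divide_pos_pos interiorI open_ball zero_less_one)
qed

lemma pairing_int: "m \<in> lattice_points \<Longrightarrow> a \<in> dual_normals \<Longrightarrow> a \<bullet> m \<in> \<int>"
  by (auto simp: lattice_points_def dual_normals_def intro: inner_int_lattice)

lemma pairing_le: "m \<in> lattice_points \<Longrightarrow> a \<in> dual_normals \<Longrightarrow> a \<bullet> m \<le> 1"
  using Delta_eq_halfspaces by (auto simp: lattice_points_def)

text \<open>
  The integrality that reflexivity provides: each of these pairings is an integer and at most \<open>1\<close>.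
\<close>

lemma pairing_pos: "m \<in> lattice_points \<Longrightarrow> a \<in> dual_normals \<Longrightarrow> 0 < a \<bullet> m \<Longrightarrow> a \<bullet> m = 1"
  by (rule Ints_pos_le_1[OF pairing_int _ pairing_le])

lemma dual_normal_unimodular:
  assumes a: "a \<in> dual_normals"
  shows "\<exists>m\<in>lattice_points. a \<bullet> m = 1"
proof -
  obtain V where V: "V \<subseteq> int_lattice" "\<Delta> = convex hull V"
    using reflexive by (auto simp: reflexive_polytope_def lattice_polytope_def)
  have "a \<noteq> 0"
    using a by (simp add: dual_normals_def)
  then obtain m where m: "m \<in> V" "0 < a \<bullet> m"
    using hull_positive_vertex[of V a] zero_in_Delta(1) V(2) by blast
  have "V \<subseteq> \<Delta>"
    unfolding V(2) by (rule hull_subset)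
  then have "m \<in> lattice_points"
    using m V(1) by (auto simp: lattice_points_def)
  then show ?thesis
    using pairing_pos[OF _ a m(2)] by blast
qed

lemma lattice_point_unimodular:
  assumes m: "m \<in> lattice_points"
  shows "\<exists>a\<in>dual_normals. a \<bullet> m = 1"
proof -
  obtain V where V: "V \<subseteq> int_lattice" "dual_polytope \<Delta> = convex hull V"
    using reflexive by (auto simp: reflexive_polytope_def lattice_polytope_def)
  have "m \<noteq> 0"
    using m by (simp add: lattice_points_def)
  then obtain a where a: "a \<in> V" "0 < m \<bullet> a"
    using hull_positive_vertex[of V m] zero_in_interior_dual V(2) by metis
  have "V \<subseteq> dual_polytope \<Delta>"
    unfolding V(2) by (rule hull_subset)
  then have "a \<in> dual_normals"
    using a V(1) by (auto simp: dual_normals_def)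
  then show ?thesis
    using pairing_pos[OF m] a(2) by (metis inner_commute)
qed

lemma finite_lattice_points: "finite lattice_points"
  unfolding lattice_points_def
  by (rule finite_Diff[OF finite_bounded_int_lattice[OF polytope_imp_bounded[OF polytope_Delta]]])

sublocale A: lattice_normal_polytope \<Delta> dual_normals "\<lambda>_. 1"
proof
  have "bounded (dual_polytope \<Delta>)"
    using reflexive
    by (auto simp: reflexive_polytope_def lattice_polytope_def intro: finite_imp_bounded_convex_hull)
  then show "finite dual_normals"
    unfolding dual_normals_def by (rule finite_Diff[OF finite_bounded_int_lattice])
  show "bounded \<Delta>"
    by (rule polytope_imp_bounded[OF polytope_Delta])
  show "\<Delta> = {x. \<forall>a\<in>dual_normals. a \<bullet> x \<le> 1}"
    by (rule Delta_eq_halfspaces)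
  show "\<exists>u\<in>int_lattice. a \<bullet> u = 1" if "a \<in> dual_normals" for a
    using dual_normal_unimodular[OF that] by (auto simp: lattice_points_def)
qed (auto simp: dual_normals_def)

sublocale B: lattice_normal_polytope "\<Delta>\<^sub>h" lattice_points "\<lambda>m. of_int (h m)"
proof
  show eq: "\<Delta>\<^sub>h = {n. \<forall>m\<in>lattice_points. m \<bullet> n \<le> of_int (h m)}"
    using height by (auto simp: dual_h_def lattice_points_def height_function_def)
  show "0 < real_of_int (h m)" if "m \<in> lattice_points" for m
    using height that by (auto simp: lattice_points_def height_function_def)
  show "\<exists>u\<in>int_lattice. m \<bullet> u = 1" if "m \<in> lattice_points" for m
    using lattice_point_unimodular[OF that] by (auto simp: dual_normals_def inner_commute)
  show "bounded \<Delta>\<^sub>h"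
  proof -
    obtain V where V: "finite V" "V \<subseteq> int_lattice" "\<Delta> = convex hull V"
      using reflexive by (auto simp: reflexive_polytope_def lattice_polytope_def)
    have "V \<subseteq> \<Delta>"
      unfolding V(3) by (rule hull_subset)
    define H where "H = Max (insert 0 ((\<lambda>m. real_of_int (h m)) ` V))"
    obtain e where e: "e > 0" "cball 0 e \<subseteq> \<Delta>"
      using zero_in_Delta(1) mem_interior_cball by blast
    have "norm n \<le> H / e" if n: "n \<in> \<Delta>\<^sub>h" for n
    proof (cases "n = 0")
      case True
      then show ?thesis
        using e(1) V(1) by (simp add: H_def)
    next
      case False
      have "m \<bullet> n \<le> H" if "m \<in> V" for m
      proof -
        have "m \<bullet> n \<le> of_int (h m)"
          using n that V(2) \<open>V \<subseteq> \<Delta>\<close> by (auto simp: dual_h_def)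
        also have "\<dots> \<le> H"
          unfolding H_def using that V(1) by (intro Max_ge) auto
        finally show ?thesis .
      qed
      then have "convex hull V \<subseteq> {x. n \<bullet> x \<le> H}"
        by (intro hull_minimal convex_halfspace_le) (auto simp: inner_commute)
      moreover have "(e / norm n) *\<^sub>R n \<in> cball 0 e"
        using e(1) False by simp
      ultimately have "n \<bullet> ((e / norm n) *\<^sub>R n) \<le> H"
        using e(2) V(3) by blast
      then show ?thesis
        using e(1) False by (simp add: dot_square_norm power2_eq_square field_simps)
    qed
    then show ?thesis
      by (intro boundedI)
  qed
qed (rule finite_lattice_points, auto simp: lattice_points_def)

text \<open>
  Only inequalities \<open>a \<bullet> y \<le> 1\<close> with \<open>a \<bullet> m > 0\<close> can stop the ray from \<open>x\<close> in direction \<open>m\<close>. For those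
  \<open>a \<bullet> m = 1\<close>, so the face through which the ray leaves \<open>\<Delta>\<close> contains \<open>m\<close>.
\<close>

lemma exit_facet:
  assumes x: "x \<in> \<Delta>" and m: "m \<in> lattice_points"
  obtains \<sigma> t where "\<sigma> facet_of \<Delta>" "m \<in> \<sigma>" "0 \<le> t" "x + t *\<^sub>R m \<in> \<sigma>"
proof -
  define T where "T = {a \<in> dual_normals. a \<bullet> m = 1}"
  have T: "finite T" "T \<noteq> {}"
    using A.finite_normals lattice_point_unimodular[OF m] by (auto simp: T_def)
  define t where "t = Min ((\<lambda>a. 1 - a \<bullet> x) ` T)"
  have "t \<in> (\<lambda>a. 1 - a \<bullet> x) ` T"
    unfolding t_def by (rule Min_in) (use T in auto)
  then obtain a where a: "a \<in> T" "t = 1 - a \<bullet> x"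
    by blast
  have le: "a' \<bullet> x \<le> 1" if "a' \<in> dual_normals" for a'
    using x that Delta_eq_halfspaces by blast
  have t: "0 \<le> t"
    using a le by (auto simp: T_def)
  have "a' \<bullet> (x + t *\<^sub>R m) \<le> 1" if a': "a' \<in> dual_normals" for a'
  proof (cases "0 < a' \<bullet> m")
    case True
    then have "a' \<in> T"
      using pairing_pos[OF m a'] a' by (simp add: T_def)
    then have "t \<le> 1 - a' \<bullet> x"
      unfolding t_def using T by (intro Min_le) auto
    then show ?thesis
      using \<open>a' \<in> T\<close> by (simp add: T_def inner_add_right)
  next
    case False
    then have "t * (a' \<bullet> m) \<le> 0"
      using t by (simp add: mult_le_0_iff)
    then show ?thesis
      using le[OF a'] by (simp add: inner_add_right)
  qed
  then have y: "x + t *\<^sub>R m \<in> \<Delta>"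
    using Delta_eq_halfspaces by blast
  define G where "G = \<Delta> \<inter> {z. a \<bullet> z = 1}"
  have a_normal: "a \<in> dual_normals"
    using a by (simp add: T_def)
  have mG: "m \<in> G"
    using a m by (simp add: G_def T_def lattice_points_def)
  have yG: "x + t *\<^sub>R m \<in> G"
    using a y by (simp add: G_def T_def inner_add_right)
  obtain \<sigma> where "\<sigma> facet_of \<Delta>" "G \<subseteq> \<sigma>"
    using face_of_polyhedron_subset_facet[OF A.polyhedron A.tight_face(1)[OF a_normal]]
      A.tight_face(2)[OF a_normal] mG unfolding G_def by blast
  then show thesis
    using that mG yG t by blast
qed

lemma convex_potential: "convex_on UNIV \<Psi>"
  using potential by (simp add: PP_def)

text \<open>
  Along the ray from \<open>n\<close> in direction \<open>a\<close>, the potential grows at most like the support function of \<open>\<Delta>\<close>, with slope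
  at most \<open>1\<close>, and at least with slope \<open>a \<bullet> x\<close>.
\<close>

lemma global_subgradient_in_Delta:
  assumes sub: "\<And>v. \<Psi> (n + v) \<ge> \<Psi> n + x \<bullet> v"
  shows "x \<in> \<Delta>"
proof -
  obtain C where C: "\<And>y. \<bar>\<Psi> y - (SUP m \<in> \<Delta> \<inter> int_lattice. m \<bullet> y)\<bar> \<le> C"
    using potential by (auto simp: PP_def bdd_above_def)
  obtain K where K: "\<And>m. m \<in> \<Delta> \<Longrightarrow> norm m \<le> K"
    using A.bounded bounded_iff by blast
  have "a \<bullet> x \<le> 1" if a: "a \<in> dual_normals" for a
  proof (rule ccontr)
    assume "\<not> a \<bullet> x \<le> 1"
    \<comment> \<open>far enough along the ray for the slopes to contradict each other\<close>
    define R where "R = (\<bar>K * norm n + C - \<Psi> n\<bar> + 1) / (a \<bullet> x - 1)"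
    have R: "R > 0" "R * (a \<bullet> x - 1) = \<bar>K * norm n + C - \<Psi> n\<bar> + 1"
      using \<open>\<not> a \<bullet> x \<le> 1\<close> by (auto simp: R_def)
    have "m \<bullet> (n + R *\<^sub>R a) \<le> K * norm n + R" if m: "m \<in> \<Delta> \<inter> int_lattice" for m
    proof -
      have "m \<bullet> n \<le> K * norm n"
        using norm_cauchy_schwarz[of m n] K[of m] m by (meson IntD1 mult_right_mono norm_ge_zero order_trans)
      moreover have "a \<bullet> m \<le> 1"
        using m a Delta_eq_halfspaces by blast
      ultimately show ?thesis
        using R(1) by (simp add: inner_add_right inner_commute mult_left_le add_mono)
    qed
    moreover have "0 \<in> \<Delta> \<inter> int_lattice"
      using zero_in_Delta by (simp add: int_lattice_def)
    ultimately have "(SUP m \<in> \<Delta> \<inter> int_lattice. m \<bullet> (n + R *\<^sub>R a)) \<le> K * norm n + R"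
      by (intro cSUP_least) blast+
    then have "\<Psi> (n + R *\<^sub>R a) \<le> K * norm n + R + C"
      using C[of "n + R *\<^sub>R a"] by linarith
    moreover have "\<Psi> (n + R *\<^sub>R a) \<ge> \<Psi> n + R * (a \<bullet> x)"
      using sub[of "R *\<^sub>R a"] by (simp add: inner_commute)
    ultimately show False
      using R(2) by (simp add: right_diff_distrib)
  qed
  then show ?thesis
    using Delta_eq_halfspaces by blast
qed

text \<open>
  The affine function with slope \<open>m\<close> through the graph of \<open>\<Psi>\<close> at \<open>n\<close> supports \<open>\<Psi>\<close> on all of \<open>\<Delta>\<^sub>h\<close>. This is
  stronger than a subgradient inequality on one facet, and it makes \<open>n\<close> a c-subgradient.
\<close>

definition contact :: "real ^ 'd option \<Rightarrow> real ^ 'd option \<Rightarrow> bool" where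
  "contact m n \<longleftrightarrow> (\<forall>n'\<in>\<Delta>\<^sub>h. \<Psi> n' \<ge> \<Psi> n + m \<bullet> (n' - n))"

lemma contact_monotone:
  assumes "contact m n" "contact m' n'" "n \<in> \<Delta>\<^sub>h" "n' \<in> \<Delta>\<^sub>h"
  shows "0 \<le> (m' - m) \<bullet> (n' - n)"
proof -
  have "\<Psi> n' \<ge> \<Psi> n + m \<bullet> (n' - n)" "\<Psi> n \<ge> \<Psi> n' + m' \<bullet> (n - n')"
    using assms by (auto simp: contact_def)
  then show ?thesis
    by (simp add: inner_diff_left inner_diff_right)
qed

abbreviation normal where "normal \<tau> \<equiv> outer_normal \<Delta>\<^sub>h \<tau>"

text \<open>
  The component along the normal of \<open>\<tau>\<close> is not seen by subgradients on \<open>\<tau>\<close>. It is used twice: first to extend the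
  subgradient off the hyperplane of \<open>\<tau>\<close>, and then to move to the boundary of \<open>\<Delta>\<close>. The second move increases the
  component, which only lowers the affine function on \<open>\<Delta>\<^sub>h\<close>, as \<open>\<Delta>\<^sub>h\<close> lies below the hyperplane of \<open>\<tau>\<close>.
\<close>

lemma contact_of_facet_subgradient:
  assumes \<tau>: "\<tau> facet_of \<Delta>\<^sub>h" and n: "n \<in> rel_interior \<tau>"
    and sub: "\<And>n'. n' \<in> rel_interior \<tau> \<Longrightarrow> \<Psi> n' \<ge> \<Psi> n + x \<bullet> (n' - n)"
  obtains \<sigma> t where "\<sigma> facet_of \<Delta>" "normal \<tau> \<in> \<sigma>" "x + t *\<^sub>R normal \<tau> \<in> \<sigma>"
    "contact (x + t *\<^sub>R normal \<tau>) n"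
proof -
  define m where "m = normal \<tau>"
  have m: "m \<in> lattice_points"
    unfolding m_def by (rule B.outer_normal(1)[OF \<tau>])
  have aff: "affine hull \<tau> = {y. m \<bullet> y = of_int (h m)}"
    unfolding m_def by (rule B.outer_normal(3)[OF \<tau>])
  have n\<tau>: "n \<in> \<tau>"
    using n rel_interior_subset by blast
  then have mn: "m \<bullet> n = of_int (h m)"
    using aff hull_subset[of \<tau> affine] by blast
  obtain e where e: "e > 0" "ball n e \<inter> affine hull \<tau> \<subseteq> rel_interior \<tau>"
    using openin_rel_interior[of \<tau>] n unfolding openin_contains_ball by blast
  have "\<Psi> (n + v) \<ge> \<Psi> n + x \<bullet> v" if v: "m \<bullet> v = 0" for v
  proof -
    \<comment> \<open>small enough to stay in the relative interior of \<open>\<tau>\<close>; convexity then scales up to \<open>v\<close>\<close>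
    define r where "r = min 1 (e / (2 * (norm v + 1)))"
    have r: "0 < r" "r \<le> 1"
      using e(1) by (auto simp: r_def add_nonneg_pos)
    have "r * norm v \<le> e / (2 * (norm v + 1)) * norm v"
      by (intro mult_right_mono) (auto simp: r_def)
    also have "\<dots> < e"
      using e(1) by (simp add: divide_simps add_nonneg_pos)
    finally have "n + r *\<^sub>R v \<in> ball n e"
      using r by (simp add: dist_norm)
    moreover have "n + r *\<^sub>R v \<in> affine hull \<tau>"
      using mn v by (simp add: aff inner_add_right)
    ultimately have "\<Psi> (n + r *\<^sub>R v) \<ge> \<Psi> n + r * (x \<bullet> v)"
      using sub[of "n + r *\<^sub>R v"] e(2) by auto
    moreover have "n + r *\<^sub>R v = (1 - r) *\<^sub>R n + r *\<^sub>R (n + v)"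
      by (simp add: algebra_simps)
    then have "\<Psi> (n + r *\<^sub>R v) \<le> (1 - r) * \<Psi> n + r * \<Psi> (n + v)"
      using convex_potential r unfolding convex_on_def by simp
    ultimately have "0 \<le> r * (\<Psi> (n + v) - \<Psi> n - x \<bullet> v)"
      by (simp add: algebra_simps)
    then show ?thesis
      using r(1) by (simp add: zero_le_mult_iff)
  qed
  then obtain s where s: "\<And>v. \<Psi> (n + v) \<ge> \<Psi> n + (x + s *\<^sub>R m) \<bullet> v"
    using lift_subgradient[OF convex_potential] by blast
  obtain \<sigma> t where \<sigma>: "\<sigma> facet_of \<Delta>" "m \<in> \<sigma>" "0 \<le> t" "(x + s *\<^sub>R m) + t *\<^sub>R m \<in> \<sigma>"
    using exit_facet[OF global_subgradient_in_Delta[OF s] m] by blast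
  have eq: "x + (s + t) *\<^sub>R m = (x + s *\<^sub>R m) + t *\<^sub>R m"
    by (simp add: scaleR_left_distrib)
  have "contact (x + (s + t) *\<^sub>R m) n"
    unfolding contact_def
  proof
    fix n' assume "n' \<in> \<Delta>\<^sub>h"
    then have "m \<bullet> n' \<le> of_int (h m)"
      using m B.halfspaces by blast
    then have "t * (m \<bullet> (n' - n)) \<le> 0"
      using \<sigma>(3) mn by (simp add: inner_diff_right mult_le_0_iff)
    then show "\<Psi> n' \<ge> \<Psi> n + (x + (s + t) *\<^sub>R m) \<bullet> (n' - n)"
      using s[of "n' - n"] unfolding eq by (simp add: inner_add_left)
  qed
  then show thesis
    using that \<sigma> eq m_def by metis
qed

section \<open>The Monge--Ampere equation as a transport inequality\<close>

lemma continuous_potential: "continuous_on X \<Psi>"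
  using convex_on_continuous[OF open_UNIV convex_potential] continuous_on_subset by blast

definition contact_set :: "(real ^ 'd option) set \<Rightarrow> (real ^ 'd option) set \<Rightarrow> (real ^ 'd option) set" where
  "contact_set \<sigma> K = {m \<in> \<sigma>. \<exists>n\<in>K. contact m n}"

lemma compact_contact_set:
  assumes "compact \<sigma>" "compact K"
  shows "compact (contact_set \<sigma> K)"
proof -
  define R where "R = {z \<in> \<sigma> \<times> K. contact (fst z) (snd z)}"
  have "closed {z. \<Psi> (snd z) + fst z \<bullet> (n' - snd z) \<le> \<Psi> n'}" for n'
    by (intro closed_Collect_le continuous_intros continuous_on_compose2[OF continuous_potential[of UNIV]]) auto
  then have "closed (\<Inter>n'\<in>\<Delta>\<^sub>h. {z. \<Psi> (snd z) + fst z \<bullet> (n' - snd z) \<le> \<Psi> n'})"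
    by blast
  moreover have "R = (\<sigma> \<times> K) \<inter> (\<Inter>n'\<in>\<Delta>\<^sub>h. {z. \<Psi> (snd z) + fst z \<bullet> (n' - snd z) \<le> \<Psi> n'})"
    by (auto simp: R_def contact_def)
  ultimately have "compact R"
    using assms by (simp add: compact_Int_closed compact_Times)
  then have "compact (fst ` R)"
    by (intro compact_continuous_image continuous_intros)
  moreover have "fst ` R = contact_set \<sigma> K"
    unfolding R_def contact_set_def by force
  ultimately show ?thesis
    by simp
qed

lemma normal_lattice:
  assumes "\<tau> facet_of \<Delta>\<^sub>h"
  shows "normal \<tau> \<in> lattice_points" "normal \<tau> \<in> int_lattice" "normal \<tau> \<in> \<Delta>"
  using B.outer_normal(1)[OF assms] by (auto simp: lattice_points_def)

lemma normal_of_Delta_facet: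
  assumes "\<sigma> facet_of \<Delta>"
  shows "outer_normal \<Delta> \<sigma> \<in> int_lattice" "x \<in> \<sigma> \<Longrightarrow> outer_normal \<Delta> \<sigma> \<bullet> x = 1"
  using A.outer_normal(1)[OF assms] A.int by (auto simp: A.mem_facet_iff[OF assms])

lemma facet_containing_normal:
  assumes "\<tau> facet_of \<Delta>\<^sub>h"
  obtains \<sigma> where "\<sigma> facet_of \<Delta>" "normal \<tau> \<in> \<sigma>"
  using exit_facet[OF zero_in_Delta(2) normal_lattice(1)[OF assms]] by metis

text \<open>
  The set \<open>Q\<close> is the image of \<open>Y\<close> under the projection along \<open>m\<close>. In the chart of \<open>\<sigma>\<close> this projection is a lattice
  automorphism followed by a translation.
\<close>

lemma shadow_measure:
  fixes v :: "real ^ 'd option"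
  assumes m: "m \<in> int_lattice" "m \<in> \<sigma>" and v: "v \<in> int_lattice" "v \<bullet> m = 1"
    and \<sigma>: "\<sigma> facet_of \<Delta>" and Y: "compact Y" "Y \<subseteq> \<sigma>"
  defines "Q \<equiv> {p. \<exists>t. perp_chart v p + t *\<^sub>R m \<in> Y}"
  shows "compact Q" "emeasure lborel Q = emeasure lborel (facet_chart \<Delta> \<sigma> -` Y)"
proof -
  define w where "w = outer_normal \<Delta> \<sigma>"
  have w: "w \<in> int_lattice" "w \<bullet> m = 1"
    using normal_of_Delta_facet[OF \<sigma>] m by (auto simp: w_def)
  define L where "L = (\<lambda>y. project_coords m v (perp_chart w y))"
  define a where "a = project_coords m v (SOME p. p \<in> \<sigma>)"
  let ?Z = "facet_chart \<Delta> \<sigma> -` Y"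
  have Z: "compact ?Z"
    by (rule A.compact_chart_vimage[OF \<sigma> Y(1)])
  have L: "lattice_automorphism L"
    unfolding L_def by (rule lattice_automorphism_project_coords[OF m(1) v w])
  have "project_coords m v (facet_chart \<Delta> \<sigma> y) = a + L y" for y
    unfolding facet_chart_def a_def L_def w_def
    by (rule linear_add[OF linear_project_coords[OF m(1) v]])
  then have "project_coords m v ` (facet_chart \<Delta> \<sigma> ` ?Z) = (+) a ` (L ` ?Z)"
    by (simp only: image_image)
  moreover have "Q = project_coords m v ` Y"
  proof (intro equalityI subsetI)
    fix p assume "p \<in> Q"
    then obtain t where t: "perp_chart v p + t *\<^sub>R m \<in> Y"
      by (auto simp: Q_def)
    have "project_coords m v (perp_chart v p + t *\<^sub>R m) = p"
      by (rule project_coords_eqI[OF m(1) v, of _ _ t]) simp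
    then show "p \<in> project_coords m v ` Y"
      using t by (metis image_eqI)
  next
    fix p assume "p \<in> project_coords m v ` Y"
    then obtain x where x: "x \<in> Y" "p = project_coords m v x"
      by blast
    then have "perp_chart v p + (v \<bullet> x) *\<^sub>R m = x"
      by (simp add: perp_chart_project_coords[OF m(1) v])
    then show "p \<in> Q"
      using x(1) unfolding Q_def by (metis (mono_tags, lifting) mem_Collect_eq)
  qed
  ultimately have Q: "Q = (+) a ` (L ` ?Z)"
    using A.image_chart_vimage[OF \<sigma> Y(2)] by simp
  show "compact Q"
    unfolding Q by (intro compact_translation emeasure_lattice_automorphism(2)[OF L Z])
  show "emeasure lborel Q = emeasure lborel ?Z"
    unfolding Q using emeasure_lattice_automorphism[OF L Z] by (simp add: emeasure_lborel_translation)
qed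

text \<open>
  A difference of points in \<open>\<tau>\<close> is orthogonal to the normal of \<open>\<tau>\<close>, and \<open>beta\<close> vanishes on it only if it is also
  orthogonal to the lattice orthogonal to the normal of \<open>\<sigma>\<close>. Together these span the space.
\<close>

lemma inj_on_beta:
  assumes \<tau>: "\<tau> facet_of \<Delta>\<^sub>h" and \<sigma>: "\<sigma> facet_of \<Delta>" "normal \<tau> \<in> \<sigma>"
  shows "inj_on (beta \<Delta> \<sigma>) (rel_interior \<tau>)"
proof (rule inj_onI)
  fix n n'
  assume nn: "n \<in> rel_interior \<tau>" "n' \<in> rel_interior \<tau>" "beta \<Delta> \<sigma> n = beta \<Delta> \<sigma> n'"
  let ?v = "outer_normal \<Delta> \<sigma>" and ?m = "normal \<tau>"
  have v: "?v \<in> int_lattice" "?v \<bullet> ?m = 1"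
    using normal_of_Delta_facet[OF \<sigma>(1)] \<sigma>(2) by auto
  have "n \<in> \<tau>" "n' \<in> \<tau>"
    using nn rel_interior_subset by blast+
  then have m: "?m \<bullet> (n - n') = 0"
    by (simp add: inner_diff_right B.mem_facet_iff[OF \<tau>])
  have "z \<bullet> (n - n') = 0" for z
  proof -
    have "perp_chart ?v (project_coords ?m ?v z) \<bullet> (n - n') = 0"
      using nn(3) by (simp add: inner_diff_right inner_beta[symmetric])
    then show ?thesis
      using m by (simp add: perp_chart_project_coords[OF normal_lattice(2)[OF \<tau>] v] inner_diff_left)
  qed
  then show "n = n'"
    by (metis inner_eq_zero_iff right_minus_eq)
qed

text \<open>
  By the equation, the left-hand side is the volume of the set \<open>P\<close> of local subgradients in the coordinates
  of one facet \<open>\<rho>\<close>. Each of them is the projection along the normal of \<open>\<tau>\<close> of a contact point on some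
  facet \<open>\<sigma>\<close> containing this normal.
\<close>

lemma MA_le_contact_sets:
  assumes MA: "MA_equation \<Delta> h \<Psi>" and \<tau>: "\<tau> facet_of \<Delta>\<^sub>h"
    and K: "compact K" "K \<subseteq> rel_interior \<tau>"
  shows "emeasure (nu \<Delta> h) K \<le>
    (\<Sum>\<sigma> | \<sigma> facet_of \<Delta> \<and> normal \<tau> \<in> \<sigma>. emeasure lborel (facet_chart \<Delta> \<sigma> -` contact_set \<sigma> K))"
proof -
  obtain \<rho> where \<rho>: "\<rho> facet_of \<Delta>" "normal \<tau> \<in> \<rho>"
    using facet_containing_normal[OF \<tau>] .
  define m v where "m = normal \<tau>" and "v = outer_normal \<Delta> \<rho>"
  have m: "m \<in> int_lattice" and v: "v \<in> int_lattice" "v \<bullet> m = 1"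
    using normal_lattice[OF \<tau>] normal_of_Delta_facet[OF \<rho>(1)] \<rho>(2) by (auto simp: m_def v_def)
  define S where "S = {\<sigma>. \<sigma> facet_of \<Delta> \<and> m \<in> \<sigma>}"
  have S: "finite S"
    using A.finite_facets by (rule rev_finite_subset) (auto simp: S_def)
  define Q where "Q \<sigma> = {p. \<exists>t. perp_chart v p + t *\<^sub>R m \<in> contact_set \<sigma> K}" for \<sigma>
  have cs: "compact (contact_set \<sigma> K)" "contact_set \<sigma> K \<subseteq> \<sigma>" if "\<sigma> \<in> S" for \<sigma>
    using that A.facet_compact K(1) by (auto simp: S_def contact_set_def intro!: compact_contact_set[unfolded contact_set_def])
  have Q: "compact (Q \<sigma>)" "emeasure lborel (Q \<sigma>) = emeasure lborel (facet_chart \<Delta> \<sigma> -` contact_set \<sigma> K)"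
    if "\<sigma> \<in> S" for \<sigma>
    unfolding Q_def using shadow_measure[OF m _ v _ cs[OF that]] that by (auto simp: S_def)
  define u where "u = \<Psi> \<circ> inv_into (rel_interior \<tau>) (beta \<Delta> \<rho>)"
  have u: "u (beta \<Delta> \<rho> n) = \<Psi> n" if "n \<in> rel_interior \<tau>" for n
    using inv_into_f_f[OF inj_on_beta[OF \<tau> \<rho>] that] by (simp add: u_def)
  define P where "P = (\<Union>x\<in>beta \<Delta> \<rho> ` K. subgradient (beta \<Delta> \<rho> ` rel_interior \<tau>) u x)"
  have "P \<subseteq> (\<Union>\<sigma>\<in>S. Q \<sigma>)"
  proof
    fix p assume "p \<in> P"
    then obtain n where n: "n \<in> K" "p \<in> subgradient (beta \<Delta> \<rho> ` rel_interior \<tau>) u (beta \<Delta> \<rho> n)"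
      by (auto simp: P_def)
    have nr: "n \<in> rel_interior \<tau>"
      using n(1) K(2) by blast
    have "\<Psi> n' \<ge> \<Psi> n + perp_chart v p \<bullet> (n' - n)" if n': "n' \<in> rel_interior \<tau>" for n'
    proof -
      have "u (beta \<Delta> \<rho> n') \<ge> u (beta \<Delta> \<rho> n) + p \<bullet> (beta \<Delta> \<rho> n' - beta \<Delta> \<rho> n)"
        using n(2) n' by (auto simp: subgradient_def)
      then show ?thesis
        using u[OF nr] u[OF n'] by (simp add: inner_diff_right inner_beta v_def)
    qed
    then obtain \<sigma> t where "\<sigma> facet_of \<Delta>" "normal \<tau> \<in> \<sigma>"
        "perp_chart v p + t *\<^sub>R normal \<tau> \<in> \<sigma>" "contact (perp_chart v p + t *\<^sub>R normal \<tau>) n"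
      using contact_of_facet_subgradient[OF \<tau> nr] by blast
    then show "p \<in> (\<Union>\<sigma>\<in>S. Q \<sigma>)"
      using n(1) by (auto simp: S_def Q_def contact_set_def m_def)
  qed
  moreover have Qsets: "Q ` S \<subseteq> sets lborel"
    using Q(1) by (auto simp: borel_compact)
  ultimately have "emeasure lebesgue P \<le> emeasure lebesgue (\<Union>\<sigma>\<in>S. Q \<sigma>)"
    using S by (intro emeasure_mono) (auto intro!: sets.finite_UN sets_completionI_sets)
  also have "\<dots> = emeasure lborel (\<Union>\<sigma>\<in>S. Q \<sigma>)"
    using sets.finite_UN[OF S, of Q lborel] Qsets by (simp add: image_subset_iff)
  also have "\<dots> \<le> (\<Sum>\<sigma>\<in>S. emeasure lborel (Q \<sigma>))"
    by (rule emeasure_subadditive_finite[OF S Qsets])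
  also have "\<dots> = (\<Sum>\<sigma>\<in>S. emeasure lborel (facet_chart \<Delta> \<sigma> -` contact_set \<sigma> K))"
    by (rule sum.cong[OF refl Q(2)])
  also have "emeasure lebesgue P = emeasure (nu \<Delta> h) K"
    using MA \<tau> \<rho> K borel_compact[OF K(1)] unfolding MA_equation_def P_def u_def by blast
  finally show ?thesis
    by (simp add: S_def m_def)
qed

text \<open>
  The difference \<open>w\<close> of the two normals is parallel to \<open>\<sigma>\<close>, and \<open>w \<bullet> n - w \<bullet> n' > 0\<close> for \<open>n\<close>, \<open>n'\<close> in the relative interiors
  of \<open>\<tau>\<close>, \<open>\<tau>'\<close>, since each facet maximizes its normal. By monotonicity of subgradients, a line in
  direction \<open>w\<close> meets the intersection at most once.
\<close>

lemma contact_sets_almost_disjoint: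
  assumes \<sigma>: "\<sigma> facet_of \<Delta>"
    and \<tau>: "\<tau> facet_of \<Delta>\<^sub>h" "normal \<tau> \<in> \<sigma>" "compact K" "K \<subseteq> rel_interior \<tau>"
    and \<tau>': "\<tau>' facet_of \<Delta>\<^sub>h" "normal \<tau>' \<in> \<sigma>" "compact K'" "K' \<subseteq> rel_interior \<tau>'"
    and ne: "\<tau> \<noteq> \<tau>'"
  shows "emeasure lborel (facet_chart \<Delta> \<sigma> -` contact_set \<sigma> K \<inter> facet_chart \<Delta> \<sigma> -` contact_set \<sigma> K') = 0"
proof -
  define w where "w = normal \<tau> - normal \<tau>'"
  define v where "v = outer_normal \<Delta> \<sigma>"
  have "v \<bullet> w = 0"
    using normal_of_Delta_facet(2)[OF \<sigma>] \<tau>(2) \<tau>'(2) by (simp add: v_def w_def inner_diff_right)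
  then obtain d where d: "w = perp_chart v d"
    using A.perp_chart_facet(2)[OF \<sigma>] unfolding v_def by blast
  let ?Z = "facet_chart \<Delta> \<sigma> -` contact_set \<sigma> K \<inter> facet_chart \<Delta> \<sigma> -` contact_set \<sigma> K'"
  have cpt: "compact ?Z"
    using \<sigma> \<tau> \<tau>' A.facet_compact
    by (intro compact_Int A.compact_chart_vimage compact_contact_set) auto
  show ?thesis
  proof (rule transversal_null[OF cpt, of d])
    fix y t assume y: "y \<in> ?Z" and t: "(0::real) < t"
    show "y + t *\<^sub>R d \<notin> ?Z"
    proof
      assume "y + t *\<^sub>R d \<in> ?Z"
      then obtain n' where n': "n' \<in> K'" "contact (facet_chart \<Delta> \<sigma> (y + t *\<^sub>R d)) n'"
        by (auto simp: contact_set_def)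
      obtain n where n: "n \<in> K" "contact (facet_chart \<Delta> \<sigma> y) n"
        using y by (auto simp: contact_set_def)
      have in_\<tau>: "n \<in> rel_interior \<tau>" "n' \<in> rel_interior \<tau>'" "n \<in> \<tau>" "n' \<in> \<tau>'"
        using n n' \<tau>(4) \<tau>'(4) rel_interior_subset by blast+
      then have mem: "n \<in> \<Delta>\<^sub>h" "n' \<in> \<Delta>\<^sub>h"
        using facet_of_imp_subset \<tau>(1) \<tau>'(1) by blast+
      have "facet_chart \<Delta> \<sigma> (y + t *\<^sub>R d) - facet_chart \<Delta> \<sigma> y = t *\<^sub>R w"
        by (simp add: facet_chart_def d v_def linear_add[OF linear_perp_chart]
            linear_cmul[OF linear_perp_chart])
      then have "0 \<le> (t *\<^sub>R w) \<bullet> (n' - n)"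
        using contact_monotone[OF n(2) n'(2) mem] by simp
      then have le: "w \<bullet> n \<le> w \<bullet> n'"
        using t by (simp add: inner_diff_right zero_le_mult_iff)
      have eq: "normal \<tau> \<bullet> n = of_int (h (normal \<tau>))" "normal \<tau>' \<bullet> n' = of_int (h (normal \<tau>'))"
        using in_\<tau>(3,4) by (simp_all add: B.mem_facet_iff[OF \<tau>(1)] B.mem_facet_iff[OF \<tau>'(1)])
      have "normal \<tau> \<bullet> n' \<le> of_int (h (normal \<tau>))" "normal \<tau>' \<bullet> n \<le> of_int (h (normal \<tau>'))"
        using mem normal_lattice(1)[OF \<tau>(1)] normal_lattice(1)[OF \<tau>'(1)] B.halfspaces by blast+
      moreover have "n \<notin> \<tau>'"
        using B.facets_eqI[OF \<tau>(1) \<tau>'(1) in_\<tau>(1)] ne by blast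
      then have "normal \<tau>' \<bullet> n \<noteq> of_int (h (normal \<tau>'))"
        using mem(1) by (simp add: B.mem_facet_iff[OF \<tau>'(1)])
      ultimately show False
        using le eq by (simp add: w_def inner_diff_left)
    qed
  qed
qed

abbreviation "dual_facets \<equiv> {\<tau>. \<tau> facet_of \<Delta>\<^sub>h}"

lemma sets_nu [simp]: "sets (nu \<Delta> h) = sets borel"
  by (simp add: nu_def nu_N_def)

lemma sets_mu [simp]: "sets (mu_M \<Delta>) = sets borel"
  by (simp add: mu_M_def)

lemma mu_finite: "emeasure (mu_M \<Delta>) X \<noteq> \<infinity>"
  using A.emeasure_boundary_finite[of X] by (simp add: mu_M_def)

lemma nu_N_finite: "emeasure (nu_N \<Delta> h) X \<noteq> \<infinity>"
  using B.emeasure_boundary_finite[of X] by (simp add: nu_N_def)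

abbreviation "mass_ratio \<equiv> emeasure (mu_M \<Delta>) (frontier \<Delta>) / emeasure (nu_N \<Delta> h) (frontier \<Delta>\<^sub>h)"

lemma emeasure_nu: "emeasure (nu \<Delta> h) X = mass_ratio * emeasure (boundary_measure \<Delta>\<^sub>h) X"
  by (simp add: nu_def nu_N_def)

lemma nu_N_pos: "emeasure (nu_N \<Delta> h) (frontier \<Delta>\<^sub>h) \<noteq> 0"
  using B.boundary_pos by (simp add: nu_N_def)

lemma mass_ratio_pos: "mass_ratio \<noteq> 0"
  using A.boundary_pos nu_N_finite by (simp add: mu_M_def ennreal_divide_eq_0_iff)

lemma mass_ratio_finite: "mass_ratio \<noteq> \<infinity>"
  using mu_finite nu_N_pos by (simp add: ennreal_divide_eq_top_iff)

lemma nu_finite: "emeasure (nu \<Delta> h) X \<noteq> \<infinity>"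
  using mass_ratio_finite B.emeasure_boundary_finite[of X]
  unfolding emeasure_nu by (auto simp: ennreal_mult_eq_top_iff)

lemma nu_total: "emeasure (nu \<Delta> h) (frontier \<Delta>\<^sub>h) = emeasure (mu_M \<Delta>) (frontier \<Delta>)"
  using nu_N_pos nu_N_finite
  by (simp add: nu_def ennreal_times_divide mult.commute ennreal_mult_divide_eq)

lemma nu_facet_boundary:
  "\<tau> facet_of \<Delta>\<^sub>h \<Longrightarrow> emeasure (nu \<Delta> h) (\<tau> - rel_interior \<tau>) = 0"
  by (simp add: emeasure_nu B.emeasure_facet_boundary)

lemma nu_open_facet_pos:
  assumes "\<tau> facet_of \<Delta>\<^sub>h" "open W" "W \<inter> \<tau> \<noteq> {}"
  shows "0 < emeasure (nu \<Delta> h) (W \<inter> rel_interior \<tau>)"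
  using mass_ratio_pos B.emeasure_open_facet_pos[OF assms]
  by (simp add: emeasure_nu ennreal_zero_less_mult_iff zero_less_iff_neq_zero)

lemma B_open_inter_facet:
  assumes "\<tau> facet_of \<Delta>\<^sub>h" "n \<in> B_open \<Delta> h" "n \<in> \<tau>"
  shows "n \<in> rel_interior \<tau>"
proof -
  obtain \<tau>' where "\<tau>' facet_of \<Delta>\<^sub>h" "n \<in> rel_interior \<tau>'"
    using assms(2) by (auto simp: B_open_def)
  then show ?thesis
    using B.facets_eqI[of \<tau>' \<tau> n] assms by simp
qed

text \<open>
  Summing over the facets \<open>\<tau>\<close> and exchanging sums, the contact sets in a fixed \<open>\<sigma>\<close> overlap in null sets and are
  all contained in \<open>X \<inter> \<sigma>\<close>.
\<close>

lemma compact_transport_bound: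
  assumes MA: "MA_equation \<Delta> h \<Psi>" and K: "compact K" "K \<subseteq> B_open \<Delta> h" and X: "X \<in> sets borel"
    and cov: "\<And>\<tau> \<sigma> n m. \<tau> facet_of \<Delta>\<^sub>h \<Longrightarrow> n \<in> rel_interior \<tau> \<Longrightarrow> n \<in> K \<Longrightarrow> \<sigma> facet_of \<Delta> \<Longrightarrow>
      normal \<tau> \<in> \<sigma> \<Longrightarrow> m \<in> \<sigma> \<Longrightarrow> contact m n \<Longrightarrow> m \<in> X"
  shows "emeasure (nu \<Delta> h) K \<le> emeasure (mu_M \<Delta>) X"
proof -
  let ?C = "\<lambda>\<tau> \<sigma>. facet_chart \<Delta> \<sigma> -` contact_set \<sigma> (K \<inter> \<tau>)"
  have Kt: "compact (K \<inter> \<tau>)" "K \<inter> \<tau> \<subseteq> rel_interior \<tau>" if "\<tau> facet_of \<Delta>\<^sub>h" for \<tau>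
    using K B.facet_compact[OF that] B_open_inter_facet[OF that] by (auto simp: compact_Int)
  have C: "?C \<tau> \<sigma> \<in> sets borel" if "\<tau> facet_of \<Delta>\<^sub>h" "\<sigma> facet_of \<Delta>" for \<tau> \<sigma>
    using that Kt A.facet_compact
    by (intro borel_compact A.compact_chart_vimage compact_contact_set) auto
  have "K = (\<Union>\<tau>\<in>dual_facets. K \<inter> \<tau>)"
    using K(2) rel_interior_subset unfolding B_open_def by blast
  then have "emeasure (nu \<Delta> h) K = emeasure (nu \<Delta> h) (\<Union>\<tau>\<in>dual_facets. K \<inter> \<tau>)"
    by simp
  also have "\<dots> \<le> (\<Sum>\<tau>\<in>dual_facets. emeasure (nu \<Delta> h) (K \<inter> \<tau>))"
    using B.finite_facets Kt(1) by (intro emeasure_subadditive_finite) (auto simp: borel_compact)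
  also have "\<dots> \<le> (\<Sum>\<tau>\<in>dual_facets. \<Sum>\<sigma> | \<sigma> \<in> {\<sigma>. \<sigma> facet_of \<Delta>} \<and> normal \<tau> \<in> \<sigma>. emeasure lborel (?C \<tau> \<sigma>))"
    using MA_le_contact_sets[OF MA] Kt by (intro sum_mono) auto
  also have "\<dots> = (\<Sum>\<sigma> | \<sigma> facet_of \<Delta>. \<Sum>\<tau> | \<tau> \<in> dual_facets \<and> normal \<tau> \<in> \<sigma>. emeasure lborel (?C \<tau> \<sigma>))"
    by (rule sum.swap_restrict[OF B.finite_facets A.finite_facets])
  also have "\<dots> \<le> (\<Sum>\<sigma> | \<sigma> facet_of \<Delta>. emeasure lborel (facet_chart \<Delta> \<sigma> -` (X \<inter> \<sigma>)))"
  proof (rule sum_mono)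
    fix \<sigma> assume "\<sigma> \<in> {\<sigma>. \<sigma> facet_of \<Delta>}"
    then have \<sigma>: "\<sigma> facet_of \<Delta>"
      by simp
    let ?T = "{\<tau>. \<tau> \<in> dual_facets \<and> normal \<tau> \<in> \<sigma>}"
    have "(\<Sum>\<tau>\<in>?T. emeasure lborel (?C \<tau> \<sigma>)) = emeasure lborel (\<Union>\<tau>\<in>?T. ?C \<tau> \<sigma>)"
    proof (rule sum_emeasure_almost_disjoint)
      show "finite ?T"
        using B.finite_facets by (rule rev_finite_subset) auto
      show "emeasure lborel (?C \<tau> \<sigma> \<inter> ?C \<tau>' \<sigma>) = 0" if "\<tau> \<in> ?T" "\<tau>' \<in> ?T" "\<tau> \<noteq> \<tau>'" for \<tau> \<tau>'
        using contact_sets_almost_disjoint[OF \<sigma>, of \<tau> "K \<inter> \<tau>" \<tau>' "K \<inter> \<tau>'"] that Kt by auto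
    qed (use C \<sigma> in auto)
    also have "\<dots> \<le> emeasure lborel (facet_chart \<Delta> \<sigma> -` (X \<inter> \<sigma>))"
    proof (rule emeasure_mono)
      have "contact_set \<sigma> (K \<inter> \<tau>) \<subseteq> X \<inter> \<sigma>" if "\<tau> \<in> ?T" for \<tau>
      proof
        fix m assume "m \<in> contact_set \<sigma> (K \<inter> \<tau>)"
        then obtain n where n: "n \<in> K \<inter> \<tau>" "contact m n" and m: "m \<in> \<sigma>"
          by (auto simp: contact_set_def)
        have \<tau>: "\<tau> facet_of \<Delta>\<^sub>h" "normal \<tau> \<in> \<sigma>"
          using that by auto
        have "n \<in> rel_interior \<tau>"
          using n(1) Kt(2)[OF \<tau>(1)] by blast
        then show "m \<in> X \<inter> \<sigma>"
          using cov[OF \<tau>(1) _ _ \<sigma> \<tau>(2) m n(2)] n(1) m by blast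
      qed
      then show "(\<Union>\<tau>\<in>?T. ?C \<tau> \<sigma>) \<subseteq> facet_chart \<Delta> \<sigma> -` (X \<inter> \<sigma>)"
        by blast
      show "facet_chart \<Delta> \<sigma> -` (X \<inter> \<sigma>) \<in> sets lborel"
        using measurable_sets_borel[OF facet_chart_measurable, of "X \<inter> \<sigma>"] X A.sets_facet[OF \<sigma>]
        by (simp add: sets.Int)
    qed
    finally show "(\<Sum>\<tau>\<in>?T. emeasure lborel (?C \<tau> \<sigma>)) \<le> emeasure lborel (facet_chart \<Delta> \<sigma> -` (X \<inter> \<sigma>))" .
  qed
  also have "\<dots> = emeasure (mu_M \<Delta>) X"
    by (simp add: mu_M_def A.emeasure_boundary_charts[OF X])
  finally show ?thesis .
qed

text \<open>
  Compactness makes the contact sets measurable; inner regularity of \<open>\<nu>\<close> passes to Borel sets.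
\<close>

lemma transport_bound:
  assumes MA: "MA_equation \<Delta> h \<Psi>" and E: "E \<in> sets borel" "E \<subseteq> B_open \<Delta> h" and X: "X \<in> sets borel"
    and cov: "\<And>\<tau> \<sigma> n m. \<tau> facet_of \<Delta>\<^sub>h \<Longrightarrow> n \<in> rel_interior \<tau> \<Longrightarrow> n \<in> E \<Longrightarrow> \<sigma> facet_of \<Delta> \<Longrightarrow>
      normal \<tau> \<in> \<sigma> \<Longrightarrow> m \<in> \<sigma> \<Longrightarrow> contact m n \<Longrightarrow> m \<in> X"
  shows "emeasure (nu \<Delta> h) E \<le> emeasure (mu_M \<Delta>) X"
proof -
  have "emeasure (nu \<Delta> h) E = (SUP K \<in> {K. K \<subseteq> E \<and> compact K}. emeasure (nu \<Delta> h) K)"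
    using nu_finite E(1) by (intro inner_regular) auto
  also have "\<dots> \<le> emeasure (mu_M \<Delta>) X"
  proof (rule SUP_least)
    fix K assume "K \<in> {K. K \<subseteq> E \<and> compact K}"
    then have K: "K \<subseteq> E" "compact K"
      by auto
    show "emeasure (nu \<Delta> h) K \<le> emeasure (mu_M \<Delta>) X"
    proof (rule compact_transport_bound[OF MA K(2) subset_trans[OF K(1) E(2)] X])
      fix \<tau> \<sigma> n m
      assume "\<tau> facet_of \<Delta>\<^sub>h" "n \<in> rel_interior \<tau>" "n \<in> K" "\<sigma> facet_of \<Delta>"
        "normal \<tau> \<in> \<sigma>" "m \<in> \<sigma>" "contact m n"
      then show "m \<in> X"
        using cov K(1) by blast
    qed
  qed
  finally show ?thesis .
qed

section \<open>Local structure at points of the regular part\<close>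

lemma compact_dual_frontier: "compact (frontier \<Delta>\<^sub>h)"
  using B.bounded by (rule compact_frontier_bounded)

lemma dual_frontier_nonempty: "frontier \<Delta>\<^sub>h \<noteq> {}"
  using B.boundary_pos by auto

lemma bdd_above_transform: "bdd_above ((\<lambda>n. m \<bullet> n - \<Psi> n) ` frontier \<Delta>\<^sub>h)"
proof -
  have "compact ((\<lambda>n. m \<bullet> n - \<Psi> n) ` frontier \<Delta>\<^sub>h)"
    by (intro compact_continuous_image continuous_intros continuous_potential compact_dual_frontier)
  then show ?thesis
    by (intro bounded_imp_bdd_above compact_imp_bounded)
qed

lemma transform_upper: "n \<in> frontier \<Delta>\<^sub>h \<Longrightarrow> m \<bullet> n - \<Psi> n \<le> c_transform \<Delta> h \<Psi> m"
  unfolding c_transform_def by (rule cSUP_upper[OF _ bdd_above_transform])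

lemma transform_least:
  "(\<And>n. n \<in> frontier \<Delta>\<^sub>h \<Longrightarrow> m \<bullet> n - \<Psi> n \<le> r) \<Longrightarrow> c_transform \<Delta> h \<Psi> m \<le> r"
  unfolding c_transform_def by (rule cSUP_least[OF dual_frontier_nonempty])

lemma continuous_transform: "continuous_on X (c_transform \<Delta> h \<Psi>)"
proof -
  have "convex_on UNIV (c_transform \<Delta> h \<Psi>)"
  proof (intro convex_onI transform_least)
    fix t x y n
    assume t: "(0::real) < t" "t < 1" and n: "n \<in> frontier \<Delta>\<^sub>h"
    have "((1 - t) *\<^sub>R x + t *\<^sub>R y) \<bullet> n - \<Psi> n = (1 - t) * (x \<bullet> n - \<Psi> n) + t * (y \<bullet> n - \<Psi> n)"
      by (simp add: inner_add_left algebra_simps)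
    also have "\<dots> \<le> (1 - t) * c_transform \<Delta> h \<Psi> x + t * c_transform \<Delta> h \<Psi> y"
      using t transform_upper[OF n] by (intro add_mono mult_left_mono) auto
    finally show "((1 - t) *\<^sub>R x + t *\<^sub>R y) \<bullet> n - \<Psi> n \<le>
        (1 - t) * c_transform \<Delta> h \<Psi> x + t * c_transform \<Delta> h \<Psi> y" .
  qed simp
  then show ?thesis
    using convex_on_continuous[OF open_UNIV] continuous_on_subset by blast
qed

lemma contact_c_subgradient:
  assumes n: "n \<in> frontier \<Delta>\<^sub>h" and c: "contact m n"
  shows "n \<in> c_subgradient \<Delta> h \<Psi> m"
proof -
  have "frontier \<Delta>\<^sub>h \<subseteq> \<Delta>\<^sub>h"
    using B.closed by (simp add: frontier_subset_closed)
  then have "c_transform \<Delta> h \<Psi> m \<le> m \<bullet> n - \<Psi> n"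
    using c by (intro transform_least) (force simp: contact_def inner_diff_right)
  then have "c_transform \<Delta> h \<Psi> m' \<ge> c_transform \<Delta> h \<Psi> m + (m' - m) \<bullet> n" for m'
    using transform_upper[OF n, of m'] by (simp add: inner_diff_left)
  then show ?thesis
    using n by (simp add: c_subgradient_def)
qed

text \<open>
  It is the union of the relative frontier of \<open>\<sigma>\<close> and the other facets.
\<close>

lemma closed_frontier_minus_facet:
  assumes \<sigma>: "\<sigma> facet_of \<Delta>"
  shows "closed (frontier \<Delta> - rel_interior \<sigma>)"
proof -
  have "frontier \<Delta> - rel_interior \<sigma> = rel_frontier \<sigma> \<union> \<Union>({\<rho>. \<rho> facet_of \<Delta>} - {\<sigma>})"
  proof -
    have "rel_frontier \<sigma> = \<sigma> - rel_interior \<sigma>"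
      using compact_imp_closed[OF A.facet_compact[OF \<sigma>]] by (simp add: rel_frontier_def)
    moreover have "\<rho> \<inter> rel_interior \<sigma> = {}" if "\<rho> \<in> {\<rho>. \<rho> facet_of \<Delta>} - {\<sigma>}" for \<rho>
      using A.facets_eqI[OF \<sigma>, of \<rho>] that by blast
    ultimately show ?thesis
      unfolding A.frontier_eq_facets using \<sigma> by auto
  qed
  moreover have "closed (\<Union>({\<rho>. \<rho> facet_of \<Delta>} - {\<sigma>}))"
    using A.finite_facets A.facet_compact by (intro closed_Union) (auto intro: compact_imp_closed)
  moreover have "closed (rel_frontier \<sigma>)"
    using closed_rel_boundary[OF compact_imp_closed[OF A.facet_compact[OF \<sigma>]]]
      compact_imp_closed[OF A.facet_compact[OF \<sigma>]] by (simp add: rel_frontier_def)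
  ultimately show ?thesis
    by (simp add: closed_Un)
qed

text \<open>
  The complement of \<open>U\<^sub>\<sigma>\<close> in the boundary is the projection of a compact set of pairs \<open>(m, n)\<close>.
\<close>

lemma U_set_open:
  assumes \<sigma>: "\<sigma> facet_of \<Delta>" and n: "n \<in> U_set \<Delta> h \<Psi> \<sigma>"
  obtains W where "open W" "n \<in> W" "W \<inter> frontier \<Delta>\<^sub>h \<subseteq> U_set \<Delta> h \<Psi> \<sigma>"
proof -
  let ?\<phi> = "c_transform \<Delta> h \<Psi>" and ?A = "frontier \<Delta> - rel_interior \<sigma>"
  define R where "R = {z \<in> ?A \<times> frontier \<Delta>\<^sub>h. snd z \<in> c_subgradient \<Delta> h \<Psi> (fst z)}"
  have "closed {z. ?\<phi> (fst z) + (m' - fst z) \<bullet> snd z \<le> ?\<phi> m'}" for m'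
    by (intro closed_Collect_le continuous_intros continuous_on_compose2[OF continuous_transform[of UNIV]]) auto
  then have "closed (\<Inter>m'\<in>frontier \<Delta>. {z. ?\<phi> (fst z) + (m' - fst z) \<bullet> snd z \<le> ?\<phi> m'})"
    by blast
  moreover have "R = (?A \<times> frontier \<Delta>\<^sub>h) \<inter>
      (\<Inter>m'\<in>frontier \<Delta>. {z. ?\<phi> (fst z) + (m' - fst z) \<bullet> snd z \<le> ?\<phi> m'})"
    by (auto simp: R_def c_subgradient_def)
  moreover have "compact ?A"
    using closed_frontier_minus_facet[OF \<sigma>] compact_frontier_bounded[OF A.bounded]
    by (metis Diff_subset compact_eq_bounded_closed bounded_subset)
  ultimately have "compact R"
    using compact_dual_frontier by (simp add: compact_Int_closed compact_Times)
  then have "compact (snd ` R)"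
    by (intro compact_continuous_image continuous_intros)
  then have "open (- (snd ` R))"
    by (simp add: compact_imp_closed open_Compl)
  moreover have U: "U_set \<Delta> h \<Psi> \<sigma> = frontier \<Delta>\<^sub>h - snd ` R"
  proof -
    have "snd ` R = (\<Union>m\<in>?A. c_subgradient \<Delta> h \<Psi> m)"
      by (force simp: R_def c_subgradient_def)
    then show ?thesis
      by (simp add: U_set_def)
  qed
  ultimately show thesis
    using that[of "- (snd ` R)"] n by blast
qed

lemma U_set_contact:
  assumes \<sigma>: "\<sigma> facet_of \<Delta>" and n: "n \<in> U_set \<Delta> h \<Psi> \<sigma>"
    and \<rho>: "\<rho> facet_of \<Delta>" "m \<in> \<rho>" and c: "contact m n"
  shows "m \<in> rel_interior \<sigma>" "\<rho> = \<sigma>"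
proof -
  have "n \<in> frontier \<Delta>\<^sub>h"
    using n by (simp add: U_set_def)
  then have "n \<in> c_subgradient \<Delta> h \<Psi> m"
    using contact_c_subgradient c by blast
  then show m: "m \<in> rel_interior \<sigma>"
    using n A.facet_subset_frontier[OF \<rho>(1)] \<rho>(2) by (auto simp: U_set_def)
  show "\<rho> = \<sigma>"
    using A.facets_eqI[OF \<sigma> \<rho>(1) m \<rho>(2)] by simp
qed

text \<open>
  For the last conclusion: if the normal of \<open>\<tau>\<close> is not in \<open>\<sigma>\<close>, then the points of \<open>\<tau>\<close> near \<open>n\<^sub>0\<close> have no contact on
  a facet containing this normal. The transport bound with \<open>X = {}\<close> gives them mass \<open>0\<close>, but they have positive mass.
\<close>

lemma regular_neighbourhood:
  assumes MA: "MA_equation \<Delta> h \<Psi>" and \<sigma>: "\<sigma> facet_of \<Delta>" and n\<^sub>0: "n\<^sub>0 \<in> U_set \<Delta> h \<Psi> \<sigma>"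
  obtains W where "open W" "n\<^sub>0 \<in> W"
    "\<And>\<rho> n m. n \<in> W \<inter> B_open \<Delta> h \<Longrightarrow> \<rho> facet_of \<Delta> \<Longrightarrow> m \<in> \<rho> \<Longrightarrow> contact m n \<Longrightarrow>
      \<rho> = \<sigma> \<and> m \<in> rel_interior \<sigma>"
    "\<And>\<tau>. \<tau> facet_of \<Delta>\<^sub>h \<Longrightarrow> n\<^sub>0 \<in> \<tau> \<Longrightarrow> normal \<tau> \<in> \<sigma>"
proof -
  obtain W where W: "open W" "n\<^sub>0 \<in> W" "W \<inter> frontier \<Delta>\<^sub>h \<subseteq> U_set \<Delta> h \<Psi> \<sigma>"
    using U_set_open[OF \<sigma> n\<^sub>0] .
  have sub: "B_open \<Delta> h \<subseteq> frontier \<Delta>\<^sub>h"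
    using B.facet_subset_frontier rel_interior_subset unfolding B_open_def by blast
  have reg: "\<rho> = \<sigma> \<and> m \<in> rel_interior \<sigma>"
    if "n \<in> W \<inter> B_open \<Delta> h" "\<rho> facet_of \<Delta>" "m \<in> \<rho>" "contact m n" for \<rho> n m
    using U_set_contact[OF \<sigma> _ that(2-4)] that(1) W(3) sub by blast
  have "normal \<tau> \<in> \<sigma>" if \<tau>: "\<tau> facet_of \<Delta>\<^sub>h" "n\<^sub>0 \<in> \<tau>" for \<tau>
  proof (rule ccontr)
    assume "normal \<tau> \<notin> \<sigma>"
    have "emeasure (nu \<Delta> h) (W \<inter> rel_interior \<tau>) \<le> emeasure (mu_M \<Delta>) {}"
    proof (rule transport_bound[OF MA])
      show "W \<inter> rel_interior \<tau> \<in> sets borel"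
        using W(1) B.sets_rel_interior_facet[OF \<tau>(1)] by (simp add: sets.Int)
      show in_B: "W \<inter> rel_interior \<tau> \<subseteq> B_open \<Delta> h"
        using \<tau>(1) by (auto simp: B_open_def)
      fix \<tau>' \<rho> n m
      assume *: "\<tau>' facet_of \<Delta>\<^sub>h" "n \<in> rel_interior \<tau>'" "n \<in> W \<inter> rel_interior \<tau>" "\<rho> facet_of \<Delta>"
        "normal \<tau>' \<in> \<rho>" "m \<in> \<rho>" "contact m n"
      have "\<tau>' = \<tau>"
        using B.facets_eqI[OF *(1) \<tau>(1) *(2)] *(3) rel_interior_subset by blast
      moreover have "\<rho> = \<sigma>"
        using reg[OF _ *(4,6,7)] *(3) in_B by blast
      ultimately show "m \<in> {}"
        using *(5) \<open>normal \<tau> \<notin> \<sigma>\<close> by blast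
    qed simp
    moreover have "0 < emeasure (nu \<Delta> h) (W \<inter> rel_interior \<tau>)"
      using W \<tau> by (intro nu_open_facet_pos) auto
    ultimately show False
      by simp
  qed
  then show thesis
    using that[OF W(1,2)] reg by blast
qed

lemma rel_interior_B_open: "\<tau> facet_of \<Delta>\<^sub>h \<Longrightarrow> rel_interior \<tau> \<subseteq> B_open \<Delta> h"
  by (auto simp: B_open_def)

section \<open>Separation of the regular part\<close>

text \<open>
  Points of \<open>\<tau>'\<close> near \<open>n\<^sub>0\<close> have their contacts in \<open>\<sigma>\<close>, which is part of the star of the normal of \<open>\<tau>\<close>. So the star
  receives the mass of \<open>\<tau>\<close> and a positive amount in addition.
\<close>

lemma star_separation:
  assumes MA: "MA_equation \<Delta> h \<Psi>" and \<tau>: "\<tau> facet_of \<Delta>\<^sub>h"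
    and eq: "emeasure (nu \<Delta> h) \<tau> = emeasure (mu_M \<Delta>) (St \<Delta> (normal \<tau>))"
    and \<tau>': "\<tau>' facet_of \<Delta>\<^sub>h" "\<tau>' \<noteq> \<tau>" and n\<^sub>0: "n\<^sub>0 \<in> \<tau>" "n\<^sub>0 \<in> \<tau>'"
    and \<sigma>: "\<sigma> facet_of \<Delta>"
  shows "n\<^sub>0 \<notin> U_set \<Delta> h \<Psi> \<sigma>"
proof
  assume "n\<^sub>0 \<in> U_set \<Delta> h \<Psi> \<sigma>"
  then obtain W where W: "open W" "n\<^sub>0 \<in> W"
    and reg: "\<And>\<rho> n m. n \<in> W \<inter> B_open \<Delta> h \<Longrightarrow> \<rho> facet_of \<Delta> \<Longrightarrow> m \<in> \<rho> \<Longrightarrow> contact m n \<Longrightarrow>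
      \<rho> = \<sigma> \<and> m \<in> rel_interior \<sigma>"
    and normal: "\<And>\<tau>. \<tau> facet_of \<Delta>\<^sub>h \<Longrightarrow> n\<^sub>0 \<in> \<tau> \<Longrightarrow> normal \<tau> \<in> \<sigma>"
    using regular_neighbourhood[OF MA \<sigma>] by metis
  let ?E = "W \<inter> rel_interior \<tau>'" and ?X = "St \<Delta> (normal \<tau>)"
  have St: "\<rho> \<subseteq> ?X" if "\<rho> facet_of \<Delta>" "normal \<tau> \<in> \<rho>" for \<rho>
    using that facet_of_imp_face_of A.facet_proper by (auto simp: St_def)
  have sets: "rel_interior \<tau> \<in> sets borel" "?E \<in> sets borel"
    using B.sets_rel_interior_facet \<tau> \<tau>' W by (auto simp: sets.Int)
  have bound: "emeasure (nu \<Delta> h) (rel_interior \<tau> \<union> ?E) \<le> emeasure (mu_M \<Delta>) ?X"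
  proof (rule transport_bound[OF MA])
    show "rel_interior \<tau> \<union> ?E \<in> sets borel"
      using sets by (rule sets.Un)
    show "rel_interior \<tau> \<union> ?E \<subseteq> B_open \<Delta> h"
      using rel_interior_B_open \<tau> \<tau>' by blast
    have "finite {F. F face_of \<Delta> \<and> F \<noteq> \<Delta> \<and> normal \<tau> \<in> F}"
      using finite_polytope_faces[OF A.polytope] by (rule rev_finite_subset) auto
    then have "closed ?X"
      unfolding St_def
      using face_of_imp_closed[OF A.convex A.closed] by (intro closed_Union) auto
    then show "?X \<in> sets borel"
      by (rule borel_closed)
    fix \<tau>\<^sub>1 \<rho> n m
    assume *: "\<tau>\<^sub>1 facet_of \<Delta>\<^sub>h" "n \<in> rel_interior \<tau>\<^sub>1" "n \<in> rel_interior \<tau> \<union> ?E" "\<rho> facet_of \<Delta>"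
      "normal \<tau>\<^sub>1 \<in> \<rho>" "m \<in> \<rho>" "contact m n"
    show "m \<in> ?X"
    proof (cases "n \<in> rel_interior \<tau>")
      case True
      then have "\<tau>\<^sub>1 = \<tau>"
        using B.facets_eqI[OF *(1) \<tau> *(2)] rel_interior_subset by blast
      then show ?thesis
        using St *(4,5,6) by blast
    next
      case False
      then have "n \<in> W \<inter> B_open \<Delta> h"
        using *(3) rel_interior_B_open[OF \<tau>'(1)] by blast
      then have "\<rho> = \<sigma>"
        using reg *(4,6,7) by blast
      then show ?thesis
        using St[OF \<sigma> normal[OF \<tau> n\<^sub>0(1)]] *(6) by blast
    qed
  qed
  have "rel_interior \<tau> \<inter> ?E = {}"
    using B.facets_eqI[OF \<tau> \<tau>'(1)] \<tau>'(2) rel_interior_subset by blast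
  then have add: "emeasure (nu \<Delta> h) (rel_interior \<tau> \<union> ?E) =
      emeasure (nu \<Delta> h) (rel_interior \<tau>) + emeasure (nu \<Delta> h) ?E"
    using sets by (intro plus_emeasure[symmetric]) auto
  have "emeasure (nu \<Delta> h) (rel_interior \<tau> \<union> (\<tau> - rel_interior \<tau>)) \<le>
      emeasure (nu \<Delta> h) (rel_interior \<tau>) + emeasure (nu \<Delta> h) (\<tau> - rel_interior \<tau>)"
    using sets(1) B.sets_facet[OF \<tau>] by (intro emeasure_subadditive) auto
  moreover have "rel_interior \<tau> \<union> (\<tau> - rel_interior \<tau>) = \<tau>"
    using rel_interior_subset[of \<tau>] by blast
  ultimately have "emeasure (nu \<Delta> h) \<tau> \<le> emeasure (nu \<Delta> h) (rel_interior \<tau>)"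
    using nu_facet_boundary[OF \<tau>] by simp
  then have "emeasure (nu \<Delta> h) (rel_interior \<tau>) + emeasure (nu \<Delta> h) ?E \<le> emeasure (nu \<Delta> h) (rel_interior \<tau>)"
    unfolding add[symmetric] using bound eq by (metis order_trans)
  then have "emeasure (nu \<Delta> h) ?E = 0"
    by (rule ennreal_add_le_self[OF nu_finite])
  moreover have "0 < emeasure (nu \<Delta> h) ?E"
    using W \<tau>' n\<^sub>0(2) by (intro nu_open_facet_pos) auto
  ultimately show False
    by simp
qed

text \<open>
  As \<open>\<mu>\<^sub>M\<close> and \<open>\<nu>\<close> have the same total mass, \<open>eq\<close> implies that the complement \<open>X\<close> of \<open>\<sigma>\<close> has at most the mass of the
  facets with normal outside \<open>\<sigma>\<close>, whose union is \<open>E\<^sub>0\<close>. But \<open>X\<close> receives this mass and that of the part \<open>E\<close>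
  of \<open>\<tau>\<close>, whose contacts are in the interior of \<open>\<sigma>' \<noteq> \<sigma>\<close>.
\<close>

lemma facet_separation:
  assumes MA: "MA_equation \<Delta> h \<Psi>" and \<sigma>: "\<sigma> facet_of \<Delta>"
    and eq: "emeasure (mu_M \<Delta>) \<sigma> = emeasure (nu \<Delta> h) (\<Union>m \<in> \<sigma> \<inter> int_lattice. tau \<Delta> h m)"
    and \<tau>: "\<tau> facet_of \<Delta>\<^sub>h" "normal \<tau> \<in> \<sigma>" and \<tau>': "\<tau>' facet_of \<Delta>\<^sub>h" "normal \<tau>' \<notin> \<sigma>"
    and n\<^sub>0: "n\<^sub>0 \<in> \<tau>" "n\<^sub>0 \<in> \<tau>'" and \<sigma>': "\<sigma>' facet_of \<Delta>"
  shows "n\<^sub>0 \<notin> U_set \<Delta> h \<Psi> \<sigma>'"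
proof
  assume "n\<^sub>0 \<in> U_set \<Delta> h \<Psi> \<sigma>'"
  then obtain W where W: "open W" "n\<^sub>0 \<in> W"
    and reg: "\<And>\<rho> n m. n \<in> W \<inter> B_open \<Delta> h \<Longrightarrow> \<rho> facet_of \<Delta> \<Longrightarrow> m \<in> \<rho> \<Longrightarrow> contact m n \<Longrightarrow>
      \<rho> = \<sigma>' \<and> m \<in> rel_interior \<sigma>'"
    and normal: "\<And>\<tau>. \<tau> facet_of \<Delta>\<^sub>h \<Longrightarrow> n\<^sub>0 \<in> \<tau> \<Longrightarrow> normal \<tau> \<in> \<sigma>'"
    using regular_neighbourhood[OF MA \<sigma>'] by metis
  have ne: "\<sigma>' \<noteq> \<sigma>"
    using normal[OF \<tau>'(1) n\<^sub>0(2)] \<tau>'(2) by blast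
  let ?\<mu> = "emeasure (mu_M \<Delta>)" and ?\<nu> = "emeasure (nu \<Delta> h)"
  define T where "T = {\<rho>. \<rho> facet_of \<Delta>\<^sub>h \<and> normal \<rho> \<notin> \<sigma>}"
  define E\<^sub>0 where "E\<^sub>0 = (\<Union>\<rho>\<in>T. rel_interior \<rho>)"
  define E where "E = W \<inter> rel_interior \<tau>"
  define X where "X = frontier \<Delta> - rel_interior \<sigma>"
  define S where "S = (\<Union>m \<in> \<sigma> \<inter> int_lattice. tau \<Delta> h m)"
  define N where "N = (\<Union>\<rho>\<in>dual_facets. \<rho> - rel_interior \<rho>)"
  have T: "finite T"
    using B.finite_facets by (rule rev_finite_subset) (auto simp: T_def)
  have sets: "E\<^sub>0 \<in> sets borel" "E \<in> sets borel" "X \<in> sets borel" "N \<in> sets borel"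
  proof -
    show "E\<^sub>0 \<in> sets borel"
      unfolding E\<^sub>0_def using T B.sets_rel_interior_facet by (intro sets.finite_UN) (auto simp: T_def)
    show "E \<in> sets borel"
      unfolding E_def using W(1) B.sets_rel_interior_facet[OF \<tau>(1)] by (simp add: sets.Int)
    show "X \<in> sets borel"
      unfolding X_def by (rule borel_closed[OF closed_frontier_minus_facet[OF \<sigma>]])
    show "N \<in> sets borel"
      unfolding N_def using B.finite_facets B.sets_rel_interior_facet B.sets_facet
      by (intro sets.finite_UN) auto
  qed
  have S: "S \<in> sets borel"
  proof -
    have "tau \<Delta> h m = \<Delta>\<^sub>h \<inter> {n. m \<bullet> n = of_int (h m)}" for m
      by (auto simp: tau_def)
    then have "closed (tau \<Delta> h m)" for m
      using B.closed by (simp add: closed_Int closed_hyperplane)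
    moreover have "finite (\<sigma> \<inter> int_lattice)"
      by (rule finite_bounded_int_lattice[OF compact_imp_bounded[OF A.facet_compact[OF \<sigma>]]])
    ultimately show ?thesis
      unfolding S_def by (intro borel_closed closed_UN) auto
  qed
  have "?\<nu> (E\<^sub>0 \<union> E) \<le> ?\<mu> X"
  proof (rule transport_bound[OF MA _ _ sets(3)])
    show "E\<^sub>0 \<union> E \<in> sets borel"
      using sets by (intro sets.Un)
    show "E\<^sub>0 \<union> E \<subseteq> B_open \<Delta> h"
      unfolding E\<^sub>0_def E_def T_def using rel_interior_B_open \<tau>(1) by blast
    fix \<tau>\<^sub>1 \<rho> n m
    assume *: "\<tau>\<^sub>1 facet_of \<Delta>\<^sub>h" "n \<in> rel_interior \<tau>\<^sub>1" "n \<in> E\<^sub>0 \<union> E" "\<rho> facet_of \<Delta>"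
      "normal \<tau>\<^sub>1 \<in> \<rho>" "m \<in> \<rho>" "contact m n"
    have "\<rho> \<noteq> \<sigma>"
    proof (cases "n \<in> E")
      case True
      then have "n \<in> W \<inter> B_open \<Delta> h"
        unfolding E_def using rel_interior_B_open[OF \<tau>(1)] by blast
      then show ?thesis
        using reg *(4,6,7) ne by blast
    next
      case False
      then obtain \<tau>\<^sub>2 where "\<tau>\<^sub>2 \<in> T" "n \<in> rel_interior \<tau>\<^sub>2"
        using *(3) by (auto simp: E\<^sub>0_def)
      then have "\<tau>\<^sub>1 \<in> T"
        using B.facets_eqI[OF *(1) _ *(2), of \<tau>\<^sub>2] rel_interior_subset by (auto simp: T_def)
      then show ?thesis
        using *(5) by (auto simp: T_def)
    qed
    then have "m \<notin> rel_interior \<sigma>"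
      using A.facets_eqI[OF \<sigma> *(4)] *(6) by blast
    then show "m \<in> X"
      unfolding X_def using A.facet_subset_frontier[OF *(4)] *(6) by blast
  qed
  moreover have "E\<^sub>0 \<inter> E = {}"
  proof -
    have "rel_interior \<rho> \<inter> rel_interior \<tau> = {}" if "\<rho> \<in> T" for \<rho>
      using B.facets_eqI[OF \<tau>(1), of \<rho>] that \<tau>(2) rel_interior_subset[of \<rho>] by (auto simp: T_def)
    then show ?thesis
      by (auto simp: E\<^sub>0_def E_def)
  qed
  then have "?\<nu> (E\<^sub>0 \<union> E) = ?\<nu> E\<^sub>0 + ?\<nu> E"
    using sets by (intro plus_emeasure[symmetric]) auto
  ultimately have 1: "?\<nu> E\<^sub>0 + ?\<nu> E \<le> ?\<mu> X"
    by simp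
  have ri: "rel_interior \<sigma> \<in> sets borel"
    by (rule A.sets_rel_interior_facet[OF \<sigma>])
  have 2: "?\<mu> (frontier \<Delta>) = ?\<mu> X + ?\<mu> (rel_interior \<sigma>)"
  proof -
    have "rel_interior \<sigma> \<subseteq> frontier \<Delta>"
      using A.facet_subset_frontier[OF \<sigma>] rel_interior_subset by blast
    then have "frontier \<Delta> = X \<union> rel_interior \<sigma>" "X \<inter> rel_interior \<sigma> = {}"
      by (auto simp: X_def)
    then show ?thesis
      using sets(3) ri by (simp add: plus_emeasure)
  qed
  have 3: "?\<mu> \<sigma> \<le> ?\<mu> (rel_interior \<sigma>)"
  proof -
    have "rel_interior \<sigma> \<union> (\<sigma> - rel_interior \<sigma>) = \<sigma>"
      using rel_interior_subset[of \<sigma>] by blast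
    moreover have "?\<mu> (rel_interior \<sigma> \<union> (\<sigma> - rel_interior \<sigma>)) \<le>
        ?\<mu> (rel_interior \<sigma>) + ?\<mu> (\<sigma> - rel_interior \<sigma>)"
      using ri A.sets_facet[OF \<sigma>] by (intro emeasure_subadditive) auto
    ultimately show ?thesis
      using A.emeasure_facet_boundary[OF \<sigma>] by (simp add: mu_M_def)
  qed
  have "frontier \<Delta>\<^sub>h \<subseteq> (S \<union> E\<^sub>0) \<union> N"
  proof
    fix n assume "n \<in> frontier \<Delta>\<^sub>h"
    then obtain \<rho> where \<rho>: "\<rho> facet_of \<Delta>\<^sub>h" "n \<in> \<rho>"
      using B.frontier_eq_facets by blast
    show "n \<in> (S \<union> E\<^sub>0) \<union> N"
    proof (cases "normal \<rho> \<in> \<sigma>")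
      case True
      have "n \<in> tau \<Delta> h (normal \<rho>)"
        using \<rho>(2) by (simp add: tau_def B.mem_facet_iff[OF \<rho>(1)])
      then show ?thesis
        using True normal_lattice(2)[OF \<rho>(1)] by (auto simp: S_def)
    next
      case False
      then show ?thesis
        using \<rho> by (auto simp: E\<^sub>0_def N_def T_def)
    qed
  qed
  then have "?\<nu> (frontier \<Delta>\<^sub>h) \<le> ?\<nu> ((S \<union> E\<^sub>0) \<union> N)"
    using S sets by (intro emeasure_mono) auto
  also have "\<dots> \<le> ?\<nu> (S \<union> E\<^sub>0) + ?\<nu> N"
    using S sets by (intro emeasure_subadditive) auto
  also have "?\<nu> N \<le> (\<Sum>\<rho>\<in>dual_facets. ?\<nu> (\<rho> - rel_interior \<rho>))"
    unfolding N_def using B.finite_facets B.sets_facet B.sets_rel_interior_facet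
    by (intro emeasure_subadditive_finite) auto
  also have "\<dots> = 0"
    using nu_facet_boundary by (intro sum.neutral) auto
  also have "?\<nu> (S \<union> E\<^sub>0) \<le> ?\<nu> S + ?\<nu> E\<^sub>0"
    using S sets by (intro emeasure_subadditive) auto
  finally have "?\<mu> (frontier \<Delta>) \<le> ?\<mu> \<sigma> + ?\<nu> E\<^sub>0"
    by (simp add: nu_total eq S_def add_mono add_right_mono)
  then have "?\<mu> X + ?\<mu> (rel_interior \<sigma>) \<le> ?\<mu> (rel_interior \<sigma>) + ?\<nu> E\<^sub>0"
    unfolding 2 using 3 by (meson add_right_mono order_trans)
  then have "?\<mu> (rel_interior \<sigma>) + ?\<mu> X \<le> ?\<mu> (rel_interior \<sigma>) + ?\<nu> E\<^sub>0"
    by (simp add: add.commute)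
  then have "?\<mu> X \<le> ?\<nu> E\<^sub>0"
    using mu_finite by (subst (asm) ennreal_add_left_cancel_le) auto
  then have "?\<nu> E\<^sub>0 + ?\<nu> E \<le> ?\<nu> E\<^sub>0"
    using 1 by (rule order_trans[rotated])
  then have "?\<nu> E = 0"
    by (rule ennreal_add_le_self[OF nu_finite])
  moreover have "0 < ?\<nu> E"
    unfolding E_def using W \<tau>(1) n\<^sub>0(1) by (intro nu_open_facet_pos) auto
  ultimately show False
    by simp
qed

text \<open>
  A regular point that is common to two facets is not in the open part, so it is in some \<open>U\<^sub>\<sigma>\<close>.
\<close>

lemma not_connected_of_facet_partition:
  assumes G: "G \<subseteq> dual_facets" "\<tau>\<^sub>1 \<in> G" "\<tau>\<^sub>2 \<in> dual_facets - G"
    and sep: "\<And>\<tau> \<tau>' n \<sigma>. \<tau> \<in> G \<Longrightarrow> \<tau>' \<in> dual_facets - G \<Longrightarrow> n \<in> \<tau> \<Longrightarrow> n \<in> \<tau>' \<Longrightarrow>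
      \<sigma> facet_of \<Delta> \<Longrightarrow> n \<notin> U_set \<Delta> h \<Psi> \<sigma>"
  shows "\<not> connected (frontier \<Delta>\<^sub>h - Sigma_sing \<Delta> h \<Psi>)"
proof -
  let ?R = "frontier \<Delta>\<^sub>h - Sigma_sing \<Delta> h \<Psi>"
  have closed: "closed (\<Union>H)" if "H \<subseteq> dual_facets" for H
    using that B.facet_compact finite_subset[OF that B.finite_facets]
    by (intro closed_Union) (auto intro: compact_imp_closed)
  have cover: "?R \<subseteq> \<Union>G \<union> \<Union>(dual_facets - G)"
    using B.frontier_eq_facets by blast
  have meets: "\<tau> \<inter> ?R \<noteq> {}" if \<tau>: "\<tau> facet_of \<Delta>\<^sub>h" for \<tau>
  proof -
    obtain n where n: "n \<in> rel_interior \<tau>"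
      using rel_interior_eq_empty[OF B.facet_convex[OF \<tau>]] B.facet_nonempty[OF \<tau>] by blast
    then have "n \<in> \<tau>" "n \<in> B_open \<Delta> h"
      using rel_interior_subset[of \<tau>] rel_interior_B_open[OF \<tau>] by blast+
    moreover have "n \<in> frontier \<Delta>\<^sub>h"
      using B.facet_subset_frontier[OF \<tau>] \<open>n \<in> \<tau>\<close> by blast
    ultimately have "n \<in> \<tau> \<inter> ?R"
      by (simp add: Sigma_sing_def B_skel_def)
    then show ?thesis
      by blast
  qed
  have "\<Union>G \<inter> \<Union>(dual_facets - G) \<inter> ?R = {}"
  proof (rule ccontr)
    assume "\<Union>G \<inter> \<Union>(dual_facets - G) \<inter> ?R \<noteq> {}"
    then obtain n \<tau> \<tau>' where n: "n \<in> ?R" and \<tau>: "\<tau> \<in> G" "n \<in> \<tau>" and \<tau>': "\<tau>' \<in> dual_facets - G" "n \<in> \<tau>'"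
      by blast
    have facets: "\<tau> facet_of \<Delta>\<^sub>h" "\<tau>' facet_of \<Delta>\<^sub>h" and ne: "\<tau> \<noteq> \<tau>'"
      using \<tau> \<tau>' G(1) by auto
    have "n \<notin> B_open \<Delta> h"
      using B_open_inter_facet[OF facets(1) _ \<tau>(2)] B.facets_eqI[OF facets _ \<tau>'(2)] ne by blast
    then have "n \<in> B_skel \<Delta> h"
      using n by (simp add: B_skel_def)
    then obtain \<sigma> where "\<sigma> facet_of \<Delta>" "n \<in> U_set \<Delta> h \<Psi> \<sigma>"
      using n by (auto simp: Sigma_sing_def)
    then show False
      using sep[OF \<tau>(1) \<tau>'(1) \<tau>(2) \<tau>'(2)] by blast
  qed
  moreover have "\<Union>G \<inter> ?R \<noteq> {}" "\<Union>(dual_facets - G) \<inter> ?R \<noteq> {}"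
    using meets[of \<tau>\<^sub>1] meets[of \<tau>\<^sub>2] G by blast+
  ultimately show ?thesis
    unfolding connected_closed
    using closed[OF G(1)] closed[of "dual_facets - G"] cover by blast
qed

lemma regular_part_not_connected:
  assumes MA: "MA_equation \<Delta> h \<Psi>" and semi: "structurally_strictly_semistable \<Delta> h"
  shows "\<not> connected (frontier \<Delta>\<^sub>h - Sigma_sing \<Delta> h \<Psi>)"
proof -
  consider (star) \<tau> where "\<tau> facet_of \<Delta>\<^sub>h"
      "emeasure (nu \<Delta> h) \<tau> = emeasure (mu_M \<Delta>) (St \<Delta> (normal \<tau>))"
    | (facet) \<sigma> where "\<sigma> facet_of \<Delta>"
      "emeasure (mu_M \<Delta>) \<sigma> = emeasure (nu \<Delta> h) (\<Union>m \<in> \<sigma> \<inter> int_lattice. tau \<Delta> h m)"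
    using semi unfolding structurally_strictly_semistable_def by blast
  then show ?thesis
  proof cases
    case (star \<tau>)
    \<comment> \<open>the facet opposite to \<open>\<tau>\<close> shows that \<open>\<tau>\<close> is not the only one\<close>
    have "- normal \<tau> \<noteq> 0"
      using normal_lattice(1)[OF star(1)] by (simp add: lattice_points_def)
    then obtain \<tau>' where \<tau>': "\<tau>' facet_of \<Delta>\<^sub>h" "0 < normal \<tau>' \<bullet> - normal \<tau>"
      using B.facet_in_direction by blast
    have "\<tau>' \<noteq> \<tau>"
    proof
      assume "\<tau>' = \<tau>"
      then show False
        using \<tau>'(2) inner_ge_zero[of "normal \<tau>"] by simp
    qed
    then show ?thesis
      using star_separation[OF MA star] \<tau>'(1) star(1)
      by (intro not_connected_of_facet_partition[of "{\<tau>}" \<tau> \<tau>']) auto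
  next
    case (facet \<sigma>)
    define v where "v = outer_normal \<Delta> \<sigma>"
    have v: "v \<in> dual_normals"
      unfolding v_def by (rule A.outer_normal(1)[OF facet(1)])
    then have "v \<noteq> 0" "- v \<noteq> 0"
      by (auto simp: dual_normals_def)
    \<comment> \<open>facets on both sides of \<open>\<sigma>\<close>; pairings with \<open>v\<close> are at most \<open>1\<close>, so a positive one puts the normal into \<open>\<sigma>\<close>\<close>
    then obtain \<tau>\<^sub>1 \<tau>\<^sub>2 where \<tau>\<^sub>1: "\<tau>\<^sub>1 facet_of \<Delta>\<^sub>h" "0 < normal \<tau>\<^sub>1 \<bullet> v"
      and \<tau>\<^sub>2: "\<tau>\<^sub>2 facet_of \<Delta>\<^sub>h" "0 < normal \<tau>\<^sub>2 \<bullet> - v"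
      using B.facet_in_direction by metis
    have mem: "normal \<tau> \<in> \<sigma> \<longleftrightarrow> v \<bullet> normal \<tau> = 1" if "\<tau> facet_of \<Delta>\<^sub>h" for \<tau>
      using normal_lattice(3)[OF that] by (simp add: A.mem_facet_iff[OF facet(1)] v_def)
    have "normal \<tau>\<^sub>1 \<in> \<sigma>"
      unfolding mem[OF \<tau>\<^sub>1(1)] using \<tau>\<^sub>1(2)
      by (intro pairing_pos[OF normal_lattice(1)[OF \<tau>\<^sub>1(1)] v]) (simp add: inner_commute)
    moreover have "normal \<tau>\<^sub>2 \<notin> \<sigma>"
      unfolding mem[OF \<tau>\<^sub>2(1)] using \<tau>\<^sub>2(2) by (simp add: inner_commute)
    ultimately show ?thesis
      using facet_separation[OF MA facet] \<tau>\<^sub>1(1) \<tau>\<^sub>2(1)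
      by (intro not_connected_of_facet_partition[of "{\<tau>. \<tau> facet_of \<Delta>\<^sub>h \<and> normal \<tau> \<in> \<sigma>}" \<tau>\<^sub>1 \<tau>\<^sub>2]) auto
  qed
qed

end

theorem lemma24:
  fixes \<Delta> :: "(real ^ 'd::finite option) set"
    and h :: "real ^ 'd option \<Rightarrow> int"
    and \<Psi> :: "real ^ 'd option \<Rightarrow> real"
  assumes "reflexive_polytope \<Delta>"
    and "height_function \<Delta> h"
    and "structurally_strictly_semistable \<Delta> h"
    and "\<Psi> \<in> PP \<Delta>"
    and "MA_equation \<Delta> h \<Psi>"
  shows "\<not> connected (frontier (dual_h \<Delta> h) - Sigma_sing \<Delta> h \<Psi>)"
proof -
  interpret reflexive_potential \<Delta> h \<Psi>
    by unfold_locales (fact assms)+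
  show ?thesis
    by (rule regular_part_not_connected) (fact assms)+
qed

end
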